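(* Let $\gamma=(\gamma_t,t\ge 0)$ be a gamma subordinator and let $\xi$ be a random variable with values in $(0,\infty)$ which is independent of $\gamma$. Then the germ-$\sigma$-field $$\bigcap_{t>0}\sigma(\xi\gamma_s,\ 0\le s\le t)$$ is trivial, i.e. every event in this $\sigma$-field has probability either $0$ or $1$.
   Context: A gamma subordinator is a right-continuous increasing process started at $0$ with stationary independent increments, zero drift and Lévy measure $a x^{-1}e^{-bx}\,\mathrm{d}x$ on $(0,\infty)$ for some constants $a,b>0$ (so $\gamma_t$ has a gamma distribution for each $t>0$). For $t>0$, $\sigma(\xi\gamma_s,\ 0\le s\le t)$ is the $\sigma$-field generated by the random variables $\xi\gamma_s$, $0\le s\le t$. *)

theory Defs
  imports "HOL-Probability.Probability"
begin

text \<open>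
  A real-valued process indexed by \<open>[0,\<infinity>)\<close> is a function \<open>X :: real \<Rightarrow> 'a \<Rightarrow> real\<close>; its values at
  negative times are ignored throughout.
\<close>

definition process_sigma :: "'a measure \<Rightarrow> (real \<Rightarrow> 'a \<Rightarrow> real) \<Rightarrow> real set \<Rightarrow> 'a set set" where
  "process_sigma M X T =
     sigma_sets (space M) (\<Union>s\<in>T. {X s -` B \<inter> space M | B. B \<in> sets borel})"

text \<open>Null sets of \<open>M\<close> are not added to the \<open>\<sigma>\<close>-fields being intersected.\<close>

definition germ_sigma :: "'a measure \<Rightarrow> (real \<Rightarrow> 'a \<Rightarrow> real) \<Rightarrow> 'a set set" where
  "germ_sigma M X = (\<Inter>t\<in>{0<..}. process_sigma M X {0..t})"

definition (in prob_space) independent_increments :: "(real \<Rightarrow> 'a \<Rightarrow> real) \<Rightarrow> bool" where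
  "independent_increments X \<longleftrightarrow>
     (\<forall>(n::nat) (t::nat \<Rightarrow> real). 0 \<le> t 0 \<and> mono_on {..n} t \<longrightarrow>
        indep_vars (\<lambda>_. borel) (\<lambda>i \<omega>. X (t (Suc i)) \<omega> - X (t i) \<omega>) {..<n})"

definition (in prob_space) stationary_increments :: "(real \<Rightarrow> 'a \<Rightarrow> real) \<Rightarrow> bool" where
  "stationary_increments X \<longleftrightarrow>
     (\<forall>s\<ge>0. \<forall>h\<ge>0. distr M borel (\<lambda>\<omega>. X (s + h) \<omega> - X s \<omega>)
                 = distr M borel (\<lambda>\<omega>. X h \<omega> - X 0 \<omega>))"

text \<open>The path properties are only required almost surely.\<close>

definition (in prob_space) subordinator :: "(real \<Rightarrow> 'a \<Rightarrow> real) \<Rightarrow> bool" where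
  "subordinator X \<longleftrightarrow>
     (\<forall>t\<ge>0. random_variable borel (X t)) \<and>
     (AE \<omega> in M. X 0 \<omega> = 0
        \<and> mono_on {0..} (\<lambda>t. X t \<omega>)
        \<and> (\<forall>t\<ge>0. continuous (at_right t) (\<lambda>s. X s \<omega>))) \<and>
     independent_increments X \<and> stationary_increments X"

text \<open>
  The drift \<open>d\<close> and the Levy measure \<open>\<nu>\<close> of a subordinator are the parameters of its Laplace
  exponent: \<open>E exp (- l X\<^sub>t) = exp (- t (d l + \<integral> (1 - exp (- l x)) \<nu>(dx)))\<close>.
\<close>

definition subordinator_levy_measure :: "real measure \<Rightarrow> bool" where
  "subordinator_levy_measure \<nu> \<longleftrightarrow>
     sets \<nu> = sets borel \<and> emeasure \<nu> {..0} = 0 \<and>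
     (\<integral>\<^sup>+x. ennreal (min 1 x) \<partial>\<nu>) < \<infinity>"

definition laplace_exponent :: "real \<Rightarrow> real measure \<Rightarrow> real \<Rightarrow> real" where
  "laplace_exponent d \<nu> l = d * l + (\<integral>x. 1 - exp (- (l * x)) \<partial>\<nu>)"

definition (in prob_space) has_drift_and_levy_measure ::
    "(real \<Rightarrow> 'a \<Rightarrow> real) \<Rightarrow> real \<Rightarrow> real measure \<Rightarrow> bool" where
  "has_drift_and_levy_measure X d \<nu> \<longleftrightarrow>
     0 \<le> d \<and> subordinator_levy_measure \<nu> \<and>
     (\<forall>t\<ge>0. \<forall>l\<ge>0. expectation (\<lambda>\<omega>. exp (- (l * X t \<omega>))) = exp (- (t * laplace_exponent d \<nu> l)))"

definition gamma_levy_measure :: "real \<Rightarrow> real \<Rightarrow> real measure" where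
  "gamma_levy_measure a b =
     density lborel (\<lambda>x. ennreal (indicator {0<..} x * (a * inverse x * exp (- (b * x)))))"

definition (in prob_space) gamma_subordinator :: "(real \<Rightarrow> 'a \<Rightarrow> real) \<Rightarrow> bool" where
  "gamma_subordinator X \<longleftrightarrow>
     subordinator X \<and>
     (\<exists>a>0. \<exists>b>0. has_drift_and_levy_measure X 0 (gamma_levy_measure a b))"

definition (in prob_space) indep_of_process ::
    "('a \<Rightarrow> real) \<Rightarrow> (real \<Rightarrow> 'a \<Rightarrow> real) \<Rightarrow> bool" where
  "indep_of_process Y X \<longleftrightarrow>
     indep_set {Y -` B \<inter> space M | B. B \<in> sets borel} (process_sigma M X {0..})"

end

theory Submission
  imports Defs
begin

text \<open>
  Two facts about a germ event \<open>A\<close> are combined: it is independent of \<open>\<xi>\<close>, and the path of \<open>\<gamma>\<close>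
  cannot influence it beyond what \<open>\<xi>\<close> does.

  Independence of \<open>\<xi>\<close> is special to the gamma process. Multiplying \<open>\<gamma>\<close> by \<open>c\<close> changes its Levy
  density \<open>a x\<^sup>-\<^sup>1 e\<^sup>-\<^sup>b\<^sup>x\<close> only by replacing \<open>b\<close> with \<open>b / c\<close>, that is, by an exponential tilt. So on
  \<open>[0,t]\<close> the law of the path \<open>c \<gamma>\<close> has the density \<open>exp (t \<Phi>(\<theta>) - \<theta> \<gamma>\<^sub>t)\<close>, with \<open>\<theta> = b / c - b\<close>
  and \<open>\<Phi>\<close> the Laplace exponent of \<open>\<gamma>\<close>, relative to the law of \<open>\<gamma>\<close> (lemma \<open>scaled_path_law\<close>,
  for \<open>c \<le> 1\<close>). As \<open>t\<close> tends to \<open>0\<close> this density tends to \<open>1\<close>, and the two laws merge in total variation (\<open>scaling_total_variation\<close>).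
  Write \<open>A\<close> as the event that \<open>\<xi> \<gamma>\<close> restricted to \<open>[0,t]\<close> lies in \<open>B\<^sub>t\<close>. Given \<open>\<xi> = x\<close>, its
  probability differs from the probability that \<open>\<gamma>\<close> restricted to \<open>[0,t]\<close> lies in \<open>B\<^sub>t\<close> by a
  quantity that vanishes as \<open>t\<close> tends to \<open>0\<close>, and the latter probability does not involve \<open>x\<close>. Hence
  \<open>A\<close> is independent of \<open>\<xi>\<close> (\<open>germ_event_indep_scale\<close>).

  The rest is the argument behind Blumenthal's zero-one law. For every \<open>\<epsilon> > 0\<close>, \<open>A\<close> is determined by
  \<open>\<xi>\<close> and the path up to time \<open>\<epsilon>\<close>, hence the pair \<open>(A, \<xi>)\<close> is independent of the increments
  after \<open>\<epsilon>\<close> (\<open>scaled_past_future_indep\<close>). By right-continuity at \<open>0\<close> these increments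
  approximate \<open>\<gamma>\<close> as \<open>\<epsilon>\<close> tends to \<open>0\<close>, so \<open>(A, \<xi>)\<close> is independent of \<open>\<gamma>\<close>. With the first
  part, \<open>A\<close> is independent of \<open>(\<xi>, \<gamma>)\<close>, which determines \<open>A\<close>; so \<open>A\<close> is independent of itself.
\<close>

section \<open>Laws on the half-line are determined by their Laplace transforms\<close>

text \<open>
  On a bounded interval the Taylor polynomials of the characteristic function, whose coefficients are
  the moments, converge to it.
\<close>

lemma moments_unit_interval_unique:
  fixes \<mu> \<nu> :: "real measure"
  assumes "real_distribution \<mu>" "real_distribution \<nu>"
    and ae: "AE x in \<mu>. x \<in> {0..1}" "AE x in \<nu>. x \<in> {0..1}"
    and mom: "\<And>n. (\<integral>x. x ^ n \<partial>\<mu>) = (\<integral>x. x ^ n \<partial>\<nu>)"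
  shows "\<mu> = \<nu>"
proof (rule Levy_uniqueness)
  have approx: "integrable N (\<lambda>x. x ^ k)"
      "cmod (char N t - (\<Sum>k\<le>n. ((\<i> * t) ^ k / fact k) * (\<integral>x. x ^ k \<partial>N))) \<le> 2 * \<bar>t\<bar> ^ n / fact n"
    if "real_distribution N" "AE x in N. x \<in> {0..1}" for N :: "real measure" and t n k
  proof -
    interpret real_distribution N by fact
    have le1: "AE x in N. norm (x ^ k) \<le> 1" for k :: nat
      using that(2) by eventually_elim (auto simp: power_le_one norm_power)
    show int: "integrable N (\<lambda>x. x ^ k)" for k :: nat
      by (rule integrable_const_bound[OF le1]) simp
    have "(\<integral>x. \<bar>x\<bar> ^ n \<partial>N) \<le> (\<integral>x. 1 \<partial>N)"
      using le1[of n] integrable_abs[OF int[of n]]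
      by (intro integral_mono_AE) (auto simp flip: power_abs)
    then have "(2 * \<bar>t\<bar> ^ n / fact n) * (\<integral>x. \<bar>x\<bar> ^ n \<partial>N) \<le> (2 * \<bar>t\<bar> ^ n / fact n) * 1"
      using prob_space by (intro mult_left_mono) auto
    with char_approx1[of n t] int
    show "cmod (char N t - (\<Sum>k\<le>n. ((\<i> * t) ^ k / fact k) * (\<integral>x. x ^ k \<partial>N))) \<le> 2 * \<bar>t\<bar> ^ n / fact n"
      by (smt (verit, ccfv_SIG) mult.right_neutral)
  qed
  show "char \<mu> = char \<nu>"
  proof
    fix t
    have "cmod (char \<mu> t - char \<nu> t) \<le> 4 * (\<bar>t\<bar> ^ n / fact n)" for n
      using norm_triangle_le_diff[OF add_mono[OF approx(2)[OF assms(1) ae(1), of t n]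
          approx(2)[OF assms(2) ae(2), of t n]]] mom
      by simp
    moreover have "(\<lambda>n. 4 * (\<bar>t\<bar> ^ n / fact n)) \<longlonglongrightarrow> 4 * 0"
      using summable_LIMSEQ_zero[OF summable_exp[of "\<bar>t\<bar>"]]
      by (intro tendsto_intros) (simp add: field_simps)
    ultimately have "cmod (char \<mu> t - char \<nu> t) \<le> 0"
      by (intro LIMSEQ_le_const[of "\<lambda>n. 4 * (\<bar>t\<bar> ^ n / fact n)"]) auto
    then show "char \<mu> t = char \<nu> t" by simp
  qed
qed fact+

text \<open>
  The Laplace transform of \<open>X\<close> at \<open>n\<close> is the \<open>n\<close>-th moment of \<open>e\<^sup>-\<^sup>X\<close>, which lives on the unit
  interval.
\<close>

lemma laplace_transform_at_nats_unique:
  fixes \<mu> \<nu> :: "real measure"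
  assumes "real_distribution \<mu>" "real_distribution \<nu>"
    and ae: "AE x in \<mu>. 0 \<le> x" "AE x in \<nu>. 0 \<le> x"
    and lap: "\<And>n::nat. (\<integral>x. exp (- (n * x)) \<partial>\<mu>) = (\<integral>x. exp (- (n * x)) \<partial>\<nu>)"
  shows "\<mu> = \<nu>"
proof -
  interpret \<mu>: real_distribution \<mu> by fact
  interpret \<nu>: real_distribution \<nu> by fact
  let ?e = "\<lambda>x::real. exp (- x)"
  have "distr \<mu> borel ?e = distr \<nu> borel ?e"
  proof (rule moments_unit_interval_unique)
    fix n :: nat
    show "(\<integral>x. x ^ n \<partial>distr \<mu> borel ?e) = (\<integral>x. x ^ n \<partial>distr \<nu> borel ?e)"
      using lap[of n] by (simp add: integral_distr flip: exp_of_nat_mult)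
  qed (use ae in \<open>auto simp: AE_distr_iff intro!: \<mu>.real_distribution_distr \<nu>.real_distribution_distr\<close>)
  then have "distr (distr \<mu> borel ?e) borel (\<lambda>y. - ln y) = distr (distr \<nu> borel ?e) borel (\<lambda>y. - ln y)"
    by simp
  moreover have "distr (distr N borel ?e) borel (\<lambda>y. - ln y) = N" if "sets N = sets borel" for N :: "real measure"
    using that by (subst distr_distr) (auto simp: comp_def distr_id2 cong: measurable_cong_sets)
  ultimately show ?thesis by simp
qed

section \<open>Scaling a gamma variable is exponential tilting\<close>

lemma integrable_one_minus_exp:
  assumes "subordinator_levy_measure \<nu>" "0 \<le> l"
  shows "integrable \<nu> (\<lambda>x. 1 - exp (- (l * x)))"
proof -
  have [measurable_cong]: "sets \<nu> = sets borel" and null: "emeasure \<nu> {..0} = 0"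
    and fin: "(\<integral>\<^sup>+x. ennreal (min 1 x) \<partial>\<nu>) < \<infinity>"
    using assms(1) by (auto simp: subordinator_levy_measure_def)
  have pos: "AE x in \<nu>. 0 < x"
    using null by (intro AE_I[of _ _ "{..0}"]) auto
  have "(\<integral>\<^sup>+x. ennreal (norm (min 1 x)) \<partial>\<nu>) = (\<integral>\<^sup>+x. ennreal (min 1 x) \<partial>\<nu>)"
    using pos by (intro nn_integral_cong_AE) (auto elim!: eventually_mono)
  with fin have "integrable \<nu> (\<lambda>x. min 1 x)"
    by (intro integrableI_bounded) auto
  then have "integrable \<nu> (\<lambda>x. max 1 l * min 1 x)"
    by (rule integrable_mult_right)
  moreover have "norm (1 - exp (- (l * x))) \<le> norm (max 1 l * min 1 x)" if "0 < x" for x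
  proof -
    have "0 \<le> l * x" using that assms by simp
    have "1 - exp (- (l * x)) \<le> min 1 (l * x)"
      using exp_ge_add_one_self[of "- (l * x)"] by simp
    also have "l * x \<le> max 1 l * x"
      using that by (intro mult_right_mono) auto
    then have "min 1 (l * x) \<le> max 1 l * min 1 x"
      by (cases "x \<le> 1") (auto simp: min_def)
    finally have "1 - exp (- (l * x)) \<le> max 1 l * min 1 x" .
    then show ?thesis using that \<open>0 \<le> l * x\<close> by simp
  qed
  ultimately show ?thesis
    using pos by (elim Bochner_Integration.integrable_bound) (auto elim!: eventually_mono)
qed

text \<open>
  Both \<open>\<Phi> (l + \<theta>) - \<Phi> \<theta>\<close> and \<open>\<Phi> (c l)\<close> equal the integral of \<open>1 - e\<^sup>-\<^sup>l\<^sup>x\<close> against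
  \<open>a x\<^sup>-\<^sup>1 e\<^sup>-\<^sup>b\<^sup>x\<^sup>/\<^sup>c dx\<close>: in the first the tilt \<open>e\<^sup>-\<^sup>\<theta>\<^sup>x\<close> is absorbed into the Levy density, in the
  second the variable \<open>x\<close> is rescaled by \<open>c\<close>, which leaves \<open>dx / x\<close> invariant. This is the only
  place where the form of the gamma Levy measure matters.
\<close>

lemma gamma_laplace_exponent_tilt:
  assumes levy: "subordinator_levy_measure (gamma_levy_measure a b)"
    and "0 < a" "0 < b" "0 < c" "c \<le> 1" "0 \<le> l"
  defines "\<Phi> \<equiv> laplace_exponent 0 (gamma_levy_measure a b)" and "\<theta> \<equiv> b / c - b"
  shows "\<Phi> (l + \<theta>) = \<Phi> \<theta> + \<Phi> (c * l)"
proof -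
  define d where "d x = indicator {0<..} x * (a * inverse x * exp (- (b * x)))" for x :: real
  have [measurable]: "d \<in> borel_measurable borel" and d_nonneg: "0 \<le> d x" for x
    using \<open>0 < a\<close> unfolding d_def by (auto simp: indicator_def)
  have \<nu>: "gamma_levy_measure a b = density lborel (\<lambda>x. ennreal (d x))"
    unfolding gamma_levy_measure_def d_def ..
  have \<theta>: "0 \<le> \<theta>"
    using assms by (simp add: \<theta>_def field_simps)
  define g where "g x = indicator {0<..} x * (a * inverse x * exp (- (b / c * x)) * (1 - exp (- (l * x))))" for x :: real
  have "\<Phi> (l + \<theta>) - \<Phi> \<theta> = (\<integral>x. exp (- (\<theta> * x)) * (1 - exp (- (l * x))) \<partial>gamma_levy_measure a b)"
    unfolding \<Phi>_def laplace_exponent_def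
    using integrable_one_minus_exp[OF levy, of "l + \<theta>"] integrable_one_minus_exp[OF levy, of \<theta>] \<theta> \<open>0 \<le> l\<close>
    by (simp flip: Bochner_Integration.integral_diff)
       (simp add: algebra_simps exp_add flip: exp_minus exp_diff exp_add)
  also have "\<dots> = (\<integral>x. d x * (exp (- (\<theta> * x)) * (1 - exp (- (l * x)))) \<partial>lborel)"
    unfolding \<nu> using d_nonneg by (subst integral_density) auto
  also have "\<dots> = (\<integral>x. g x \<partial>lborel)"
    by (intro Bochner_Integration.integral_cong)
       (auto simp: d_def g_def \<theta>_def algebra_simps indicator_def simp flip: exp_add)
  also have "\<dots> = (\<integral>x. c * g (0 + c * x) \<partial>lborel)"
    using \<open>0 < c\<close> by (subst lborel_integral_real_affine[where c = c and t = 0]) auto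
  also have "\<dots> = (\<integral>x. d x * (1 - exp (- (c * l * x))) \<partial>lborel)"
    using \<open>0 < c\<close>
    by (intro Bochner_Integration.integral_cong)
       (auto simp: d_def g_def indicator_def zero_less_mult_iff field_simps)
  also have "\<dots> = \<Phi> (c * l)"
    unfolding \<Phi>_def laplace_exponent_def \<nu> using d_nonneg by (subst integral_density) auto
  finally show ?thesis by simp
qed

text \<open>
  The exponent identity says that the two sides have the same Laplace transform. The bound
  \<open>c \<le> 1\<close> makes \<open>\<theta>\<close> nonnegative, so that the Laplace transform is only used at nonnegative arguments.
\<close>

lemma (in prob_space) scaled_gamma_law:
  assumes gamma: "has_drift_and_levy_measure X 0 (gamma_levy_measure a b)"
    and "0 < a" "0 < b" "0 < c" "c \<le> 1" "0 \<le> h"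
    and rv [measurable]: "random_variable borel (X h)" and nonneg: "AE \<omega> in M. 0 \<le> X h \<omega>"
  defines "\<Phi> \<equiv> laplace_exponent 0 (gamma_levy_measure a b)" and "\<theta> \<equiv> b / c - b"
  shows "distr M borel (\<lambda>\<omega>. c * X h \<omega>) =
    density (distr M borel (X h)) (\<lambda>y. ennreal (exp (h * \<Phi> \<theta> - \<theta> * y)))"
    (is "?L = ?R")
proof -
  have levy: "subordinator_levy_measure (gamma_levy_measure a b)"
    and lap: "0 \<le> l \<Longrightarrow> expectation (\<lambda>\<omega>. exp (- (l * X h \<omega>))) = exp (- (h * \<Phi> l))" for l
    using gamma \<open>0 \<le> h\<close> by (auto simp: has_drift_and_levy_measure_def \<Phi>_def)
  have \<theta>: "0 \<le> \<theta>"
    using assms by (simp add: \<theta>_def field_simps)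
  have R: "(\<integral>y. exp (- (n * y)) \<partial>?R) = exp (- (h * \<Phi> (c * n)))" for n :: nat
  proof -
    have "(\<integral>y. exp (- (n * y)) \<partial>?R) = expectation (\<lambda>\<omega>. exp (h * \<Phi> \<theta> - \<theta> * X h \<omega>) * exp (- (n * X h \<omega>)))"
      by (simp add: integral_density integral_distr)
    also have "\<dots> = expectation (\<lambda>\<omega>. exp (h * \<Phi> \<theta>) * exp (- ((n + \<theta>) * X h \<omega>)))"
      by (intro Bochner_Integration.integral_cong) (auto simp: algebra_simps simp flip: exp_add)
    also have "\<dots> = exp (h * \<Phi> \<theta>) * exp (- (h * \<Phi> (n + \<theta>)))"
      using lap[of "n + \<theta>"] \<theta> by simp
    also have "\<dots> = exp (- (h * \<Phi> (c * n)))"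
      using gamma_laplace_exponent_tilt[OF levy assms(2-5), of n]
      by (simp add: \<Phi>_def \<theta>_def algebra_simps flip: exp_add)
    finally show ?thesis .
  qed
  have "real_distribution ?R"
  proof -
    have "integrable M (\<lambda>\<omega>. exp (h * \<Phi> \<theta> - \<theta> * X h \<omega>))"
      using nonneg \<theta> by (intro integrable_const_bound[of _ "exp (h * \<Phi> \<theta>)"]) (auto elim!: eventually_mono)
    then have "emeasure ?R (space ?R) = ennreal (expectation (\<lambda>\<omega>. exp (h * \<Phi> \<theta> - \<theta> * X h \<omega>)))"
      by (simp add: emeasure_density nn_integral_distr nn_integral_eq_integral)
    also have "expectation (\<lambda>\<omega>. exp (h * \<Phi> \<theta> - \<theta> * X h \<omega>)) = 1"
      using lap[OF \<theta>] by (simp add: exp_diff exp_minus divide_inverse)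
    finally have "prob_space ?R" by (intro prob_spaceI) simp
    then show ?thesis
      by (auto simp: real_distribution_def real_distribution_axioms_def)
  qed
  moreover have "real_distribution ?L" by simp
  moreover have "(\<integral>y. exp (- (n * y)) \<partial>?L) = exp (- (h * \<Phi> (c * n)))" for n :: nat
    using lap[of "c * n"] \<open>0 < c\<close> by (simp add: integral_distr ac_simps)
  moreover have "AE y in ?L. 0 \<le> y" "AE y in ?R. 0 \<le> y"
    using nonneg \<open>0 < c\<close> by (auto simp: AE_density AE_distr_iff zero_le_mult_iff elim!: eventually_mono)
  ultimately show ?thesis
    using R by (intro laplace_transform_at_nats_unique) auto
qed

section \<open>Finite-dimensional events and independent increments\<close>

lemma finite_set_increasing_enumeration:
  fixes L :: "real set"
  assumes "finite L" "L \<noteq> {}"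
  obtains \<tau> :: "nat \<Rightarrow> real" and n where "strict_mono_on {..n} \<tau>" "\<tau> ` {..n} = L"
proof
  let ?xs = "sorted_list_of_set L"
  have len: "i \<le> card L - 1 \<longleftrightarrow> i < length ?xs" for i
    using assms card_gt_0_iff[of L] by auto
  show "strict_mono_on {..card L - 1} ((!) ?xs)"
    using strict_sorted_list_of_set[of L] len by (auto simp: strict_mono_on_def sorted_wrt_nth_less)
  have "(!) ?xs ` {..card L - 1} = set ?xs"
    unfolding set_conv_nth atMost_def len by auto
  with assms show "(!) ?xs ` {..card L - 1} = L" by simp
qed

text \<open>
  A path that vanishes at \<open>\<tau> k\<close> is at each later grid point the sum of its increments from there on.
  The set \<open>S\<close> does not depend on the path, so that one \<open>S\<close> serves both \<open>\<gamma>\<close> and its multiples. Starting the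
  grid at a general index \<open>k\<close> covers the increments after a given time as well.
\<close>

lemma finite_dimensional_event_via_increments:
  fixes \<tau> :: "nat \<Rightarrow> real"
  assumes J: "finite J" "J \<subseteq> \<tau> ` {k..n}" and A: "\<And>s. s \<in> J \<Longrightarrow> A s \<in> sets borel"
  shows "\<exists>S \<in> sets (\<Pi>\<^sub>M i\<in>{k..<n}. (borel :: real measure)). \<forall>X. X (\<tau> k) = 0 \<longrightarrow>
      (\<forall>s\<in>J. X s \<in> A s) = ((\<lambda>i\<in>{k..<n}. X (\<tau> (Suc i)) - X (\<tau> i)) \<in> S)"
proof -
  let ?P = "\<Pi>\<^sub>M i\<in>{k..<n}. (borel :: real measure)"
  let ?S = "{z \<in> space ?P. \<forall>s\<in>J. \<forall>i\<in>{i \<in> {k..n}. \<tau> i = s}. (\<Sum>j\<in>{k..<i}. z j) \<in> A s}"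
  have "(\<forall>s\<in>J. X s \<in> A s) = ((\<lambda>i\<in>{k..<n}. X (\<tau> (Suc i)) - X (\<tau> i)) \<in> ?S)" if "X (\<tau> k) = 0" for X
  proof -
    have tel: "(\<Sum>j\<in>{k..<i}. (\<lambda>i\<in>{k..<n}. X (\<tau> (Suc i)) - X (\<tau> i)) j) = X (\<tau> i)" if "i \<in> {k..n}" for i
      using that \<open>X (\<tau> k) = 0\<close> sum_Suc_diff'[of k i "\<lambda>i. X (\<tau> i)"] by (subst sum.cong[OF refl]) auto
    have "(\<lambda>i\<in>{k..<n}. X (\<tau> (Suc i)) - X (\<tau> i)) \<in> ?S \<longleftrightarrow>
        (\<forall>s\<in>J. \<forall>i\<in>{i \<in> {k..n}. \<tau> i = s}. X (\<tau> i) \<in> A s)"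
      using tel by (auto simp: space_PiM)
    also have "\<dots> \<longleftrightarrow> (\<forall>s\<in>J. X s \<in> A s)"
      using J(2) by (fastforce simp: subset_iff image_iff)
    finally show ?thesis by simp
  qed
  moreover have "?S \<in> sets ?P"
  proof (intro sets.sets_Collect_finite_All)
    fix s i assume "s \<in> J" and i: "i \<in> {i \<in> {k..n}. \<tau> i = s}"
    then have [measurable]: "A s \<in> sets borel" using A by blast
    have [measurable]: "(\<lambda>z. \<Sum>j\<in>{k..<i}. z j) \<in> borel_measurable ?P"
      using i by (intro borel_measurable_sum measurable_component_singleton) auto
    show "{z \<in> space ?P. (\<Sum>j\<in>{k..<i}. z j) \<in> A s} \<in> sets ?P"
      by measurable
  qed (use J in auto)
  ultimately show ?thesis by blast
qed

text \<open>
  For independent coordinates, a product of one-dimensional changes of density is the change of density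
  of the joint law.
\<close>

lemma (in prob_space) tilt_independent_product:
  fixes W :: "'i \<Rightarrow> 'a \<Rightarrow> real" and g :: "'i \<Rightarrow> real \<Rightarrow> ennreal"
  assumes I: "finite I" and W: "indep_vars (\<lambda>_. borel) W I"
    and g [measurable]: "\<And>i. i \<in> I \<Longrightarrow> g i \<in> borel_measurable borel"
    and law: "\<And>i. i \<in> I \<Longrightarrow> distr M borel (\<lambda>\<omega>. c * W i \<omega>) = density (distr M borel (W i)) (g i)"
  shows "distr M (\<Pi>\<^sub>M i\<in>I. borel) (\<lambda>\<omega>. \<lambda>i\<in>I. c * W i \<omega>) =
    distr (density M (\<lambda>\<omega>. \<Prod>i\<in>I. g i (W i \<omega>))) (\<Pi>\<^sub>M i\<in>I. borel) (\<lambda>\<omega>. \<lambda>i\<in>I. W i \<omega>)"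
    (is "?L = ?R")
proof -
  have rv [measurable]: "i \<in> I \<Longrightarrow> random_variable borel (W i)" for i
    using W by (auto simp: indep_vars_def)
  show ?thesis
  proof (rule measure_eqI_PiM_finite[OF I])
    fix E :: "'i \<Rightarrow> real set" assume E [measurable]: "\<And>i. i \<in> I \<Longrightarrow> E i \<in> sets borel"
    have PiE_sets [measurable]: "Pi\<^sub>E I E \<in> sets (\<Pi>\<^sub>M i\<in>I. borel)"
      using I E by (intro sets_PiM_I_finite) auto
    have ind: "indicator (Pi\<^sub>E I E) (\<lambda>i\<in>I. x i) = (\<Prod>i\<in>I. indicator (E i) (x i) :: ennreal)" for x
      using I by (auto simp: indicator_def PiE_def Pi_def prod_zero_iff split: if_splits)
    have "emeasure ?L (Pi\<^sub>E I E) = (\<integral>\<^sup>+\<omega>. indicator (Pi\<^sub>E I E) (\<lambda>i\<in>I. c * W i \<omega>) \<partial>M)"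
      by (subst nn_integral_indicator[symmetric], simp, subst nn_integral_distr) auto
    also have "\<dots> = (\<Prod>i\<in>I. \<integral>\<^sup>+\<omega>. indicator (E i) (c * W i \<omega>) \<partial>M)"
      unfolding ind by (intro indep_vars_nn_integral I indep_vars_compose2[OF W]) auto
    also have "\<dots> = (\<Prod>i\<in>I. \<integral>\<^sup>+\<omega>. g i (W i \<omega>) * indicator (E i) (W i \<omega>) \<partial>M)"
    proof (rule prod.cong[OF refl])
      fix i assume i [measurable]: "i \<in> I"
      have "(\<integral>\<^sup>+\<omega>. indicator (E i) (c * W i \<omega>) \<partial>M) = (\<integral>\<^sup>+y. indicator (E i) y \<partial>distr M borel (\<lambda>\<omega>. c * W i \<omega>))"
        using i by (subst nn_integral_distr) auto
      also have "\<dots> = (\<integral>\<^sup>+\<omega>. g i (W i \<omega>) * indicator (E i) (W i \<omega>) \<partial>M)"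
        unfolding law[OF i] using i by (subst nn_integral_density, simp, simp, subst nn_integral_distr) auto
      finally show "(\<integral>\<^sup>+\<omega>. indicator (E i) (c * W i \<omega>) \<partial>M) = \<dots>" .
    qed
    also have "\<dots> = (\<integral>\<^sup>+\<omega>. (\<Prod>i\<in>I. g i (W i \<omega>) * indicator (E i) (W i \<omega>)) \<partial>M)"
      by (intro indep_vars_nn_integral[symmetric] I indep_vars_compose2[OF W]) auto
    also have "\<dots> = (\<integral>\<^sup>+\<omega>. (\<Prod>i\<in>I. g i (W i \<omega>)) * indicator (Pi\<^sub>E I E) (\<lambda>i\<in>I. W i \<omega>) \<partial>M)"
      unfolding ind by (simp add: prod.distrib)
    also have "\<dots> = emeasure ?R (Pi\<^sub>E I E)"
      by (subst nn_integral_indicator[symmetric], simp, subst nn_integral_distr, simp, simp,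
          subst nn_integral_density) auto
    finally show "emeasure ?L (Pi\<^sub>E I E) = emeasure ?R (Pi\<^sub>E I E)" .
  next
    show "range (\<lambda>_::nat. space (\<Pi>\<^sub>M i\<in>I. (borel::real measure))) \<subseteq> prod_algebra I (\<lambda>_. borel)"
      using I by (auto simp: space_PiM prod_algebra_eq_finite)
    show "emeasure ?L (space (\<Pi>\<^sub>M i\<in>I. (borel::real measure))) \<noteq> \<infinity>"
      by (subst emeasure_distr) auto
  qed auto
qed

section \<open>The law of the scaled path\<close>

locale subordinator_process = prob_space M for M :: "'a measure" +
  fixes \<gamma> :: "real \<Rightarrow> 'a \<Rightarrow> real"
  assumes sub: "subordinator \<gamma>"
begin

lemma random_variable_at [measurable (raw)]: "0 \<le> t \<Longrightarrow> random_variable borel (\<gamma> t)"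
  using sub by (simp add: subordinator_def)

lemma AE_paths:
  "AE \<omega> in M. \<gamma> 0 \<omega> = 0 \<and> mono_on {0..} (\<lambda>t. \<gamma> t \<omega>) \<and>
    (\<forall>t\<ge>0. continuous (at_right t) (\<lambda>s. \<gamma> s \<omega>))"
  using sub by (simp add: subordinator_def)

lemma AE_start: "AE \<omega> in M. \<gamma> 0 \<omega> = 0"
  using AE_paths by eventually_elim simp

lemma AE_nonneg: "0 \<le> t \<Longrightarrow> AE \<omega> in M. 0 \<le> \<gamma> t \<omega>"
  using AE_paths by eventually_elim (auto dest!: mono_onD[of _ _ 0 t])

lemma path_measurable [measurable]:
  "(\<lambda>\<omega>. \<lambda>s\<in>{0..t}. \<gamma> s \<omega>) \<in> M \<rightarrow>\<^sub>M (\<Pi>\<^sub>M s\<in>{0..t}. borel)"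
  by (intro measurable_restrict) auto

lemma increment_law:
  assumes "0 \<le> s" "s \<le> u"
  shows "distr M borel (\<lambda>\<omega>. \<gamma> u \<omega> - \<gamma> s \<omega>) = distr M borel (\<gamma> (u - s))"
proof -
  have "distr M borel (\<lambda>\<omega>. \<gamma> (s + h) \<omega> - \<gamma> s \<omega>) = distr M borel (\<lambda>\<omega>. \<gamma> h \<omega> - \<gamma> 0 \<omega>)" if "0 \<le> h" for h
    using sub assms that by (simp add: subordinator_def stationary_increments_def)
  from this[of "u - s"]
  have "distr M borel (\<lambda>\<omega>. \<gamma> u \<omega> - \<gamma> s \<omega>) = distr M borel (\<lambda>\<omega>. \<gamma> (u - s) \<omega> - \<gamma> 0 \<omega>)"
    using assms by simp
  also have "\<dots> = distr M borel (\<gamma> (u - s))"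
    using AE_start assms by (intro distr_cong_AE) (auto elim!: eventually_mono)
  finally show ?thesis .
qed

lemma increments_indep:
  assumes "strict_mono_on {..n} \<tau>" "0 \<le> \<tau> (0::nat)"
  shows "indep_vars (\<lambda>_. borel) (\<lambda>i \<omega>. \<gamma> (\<tau> (Suc i)) \<omega> - \<gamma> (\<tau> i) \<omega>) {..<n}"
  using sub assms strict_mono_on_imp_mono_on[OF assms(1)]
  unfolding subordinator_def independent_increments_def by blast

end

locale gamma_process = subordinator_process +
  fixes a b :: real
  assumes a_pos: "0 < a" and b_pos: "0 < b"
    and laplace: "has_drift_and_levy_measure \<gamma> 0 (gamma_levy_measure a b)"
begin

abbreviation \<Phi> :: "real \<Rightarrow> real" where
  "\<Phi> \<equiv> laplace_exponent 0 (gamma_levy_measure a b)"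

text \<open>
  The tilts of the increments over a grid from \<open>0\<close> to \<open>t\<close> multiply to \<open>exp (t \<Phi>(\<theta>) - \<theta> \<gamma>\<^sub>t)\<close>,
  whatever the grid; hence a single density on \<open>[0,t]\<close> accounts for all finite-dimensional laws.
\<close>

lemma scaled_path_law:
  assumes c: "0 < c" "c \<le> 1" and t: "0 < t"
  defines "\<theta> \<equiv> b / c - b"
  shows "distr M (\<Pi>\<^sub>M s\<in>{0..t}. borel) (\<lambda>\<omega>. \<lambda>s\<in>{0..t}. c * \<gamma> s \<omega>) =
    distr (density M (\<lambda>\<omega>. ennreal (exp (t * \<Phi> \<theta> - \<theta> * \<gamma> t \<omega>)))) (\<Pi>\<^sub>M s\<in>{0..t}. borel)
      (\<lambda>\<omega>. \<lambda>s\<in>{0..t}. \<gamma> s \<omega>)"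
    (is "distr M ?P ?X = distr (density M ?D) ?P ?Y")
proof (rule measure_eqI_PiM_infinite)
  have X [measurable]: "?X \<in> M \<rightarrow>\<^sub>M ?P"
    by (intro measurable_restrict) auto
  have [measurable]: "random_variable borel (\<gamma> t)"
    using t by simp
  show "finite_measure (distr M ?P ?X)"
    by (intro prob_space.finite_measure prob_space_distr) simp
  fix A :: "real \<Rightarrow> real set" and J assume J: "finite J" "J \<subseteq> {0..t}" and A: "\<And>s. s \<in> J \<Longrightarrow> A s \<in> sets borel"
  let ?R = "prod_emb {0..t} (\<lambda>_. borel) J (Pi\<^sub>E J A) :: (real \<Rightarrow> real) set"
  have R [measurable]: "?R \<in> sets ?P"
    using J A by (intro sets_PiM_I) auto
  have in_R: "(\<lambda>s\<in>{0..t}. f s) \<in> ?R \<longleftrightarrow> (\<forall>s\<in>J. f s \<in> A s)" for f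
    using J by (auto simp: prod_emb_def PiE_def Pi_def subset_iff)
  \<comment> \<open>The grid contains \<open>0\<close> and \<open>t\<close>, so that its increments add up to \<open>\<gamma> t\<close>.\<close>
  obtain \<tau> :: "nat \<Rightarrow> real" and n where \<tau>: "strict_mono_on {..n} \<tau>" "\<tau> ` {..n} = insert 0 (insert t J)"
    by (rule finite_set_increasing_enumeration[of "insert 0 (insert t J)"]) (use J in auto)
  have \<tau>_mono: "i \<le> j \<Longrightarrow> j \<le> n \<Longrightarrow> \<tau> i \<le> \<tau> j" for i j
    by (rule mono_onD[OF strict_mono_on_imp_mono_on[OF \<tau>(1)]]) auto
  have range: "\<tau> i \<in> {0..t}" if "i \<le> n" for i
  proof -
    have "\<tau> i \<in> insert 0 (insert t J)" using \<tau>(2) that by blast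
    with J t show ?thesis by auto
  qed
  have "0 \<in> \<tau> ` {..n}" "t \<in> \<tau> ` {..n}"
    using \<tau>(2) by auto
  then obtain i0 i1 where "i0 \<le> n" "\<tau> i0 = 0" "i1 \<le> n" "\<tau> i1 = t"
    by auto
  then have \<tau>0: "\<tau> 0 = 0" and \<tau>n: "\<tau> n = t"
    using range[of 0] range[of n] \<tau>_mono[of 0 i0] \<tau>_mono[of i1 n] by auto
  define W where "W i \<omega> = \<gamma> (\<tau> (Suc i)) \<omega> - \<gamma> (\<tau> i) \<omega>" for i \<omega>
  define g where "g i y = ennreal (exp ((\<tau> (Suc i) - \<tau> i) * \<Phi> \<theta> - \<theta> * y))" for i y
  have [measurable]: "g i \<in> borel_measurable borel" for i
    unfolding g_def by measurable
  have W [measurable]: "i < n \<Longrightarrow> random_variable borel (W i)" for i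
    using range[of i] range[of "Suc i"] unfolding W_def by simp
  have J_sub: "J \<subseteq> \<tau> ` {0..n}"
    using \<tau>(2) by (auto simp: atMost_atLeast0)
  obtain S where S [measurable]: "S \<in> sets (\<Pi>\<^sub>M i\<in>{0..<n}. (borel :: real measure))"
    and S_iff: "X (\<tau> 0) = 0 \<Longrightarrow>
      (\<forall>s\<in>J. X s \<in> A s) = ((\<lambda>i\<in>{0..<n}. X (\<tau> (Suc i)) - X (\<tau> i)) \<in> S)" for X
    using finite_dimensional_event_via_increments[OF J(1) J_sub, of A] A by auto
  have tilt: "distr M (\<Pi>\<^sub>M i\<in>{0..<n}. borel) (\<lambda>\<omega>. \<lambda>i\<in>{0..<n}. c * W i \<omega>) =
    distr (density M (\<lambda>\<omega>. \<Prod>i\<in>{0..<n}. g i (W i \<omega>))) (\<Pi>\<^sub>M i\<in>{0..<n}. borel) (\<lambda>\<omega>. \<lambda>i\<in>{0..<n}. W i \<omega>)"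
  proof (rule tilt_independent_product)
    show "indep_vars (\<lambda>_. borel) W {0..<n}"
      using increments_indep[OF \<tau>(1)] \<tau>0 unfolding W_def[abs_def] by (simp add: lessThan_atLeast0)
    fix i assume "i \<in> {0..<n}"
    then have i: "0 \<le> \<tau> i" "\<tau> i \<le> \<tau> (Suc i)" "i < n"
      using range[of i] \<tau>_mono[of i "Suc i"] by auto
    let ?h = "\<tau> (Suc i) - \<tau> i"
    have law: "distr M borel (W i) = distr M borel (\<gamma> ?h)"
      unfolding W_def[abs_def] using i by (intro increment_law)
    have "distr M borel (\<lambda>\<omega>. c * W i \<omega>) = distr (distr M borel (W i)) borel ((*) c)"
      using i by (simp add: distr_distr comp_def)
    also have "\<dots> = distr M borel (\<lambda>\<omega>. c * \<gamma> ?h \<omega>)"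
      unfolding law using i by (simp add: distr_distr comp_def)
    also have "\<dots> = density (distr M borel (W i)) (g i)"
      unfolding law g_def[abs_def] \<theta>_def
      using laplace a_pos b_pos c i AE_nonneg[of ?h] by (intro scaled_gamma_law) auto
    finally show "distr M borel (\<lambda>\<omega>. c * W i \<omega>) = density (distr M borel (W i)) (g i)" .
  qed auto
  have prod_g: "AE \<omega> in M. (\<Prod>i\<in>{0..<n}. g i (W i \<omega>)) = ?D \<omega>"
    using AE_start
  proof eventually_elim
    fix \<omega> assume "\<gamma> 0 \<omega> = 0"
    have "(\<Prod>i\<in>{0..<n}. g i (W i \<omega>)) = ennreal (exp (\<Sum>i\<in>{0..<n}. (\<tau> (Suc i) - \<tau> i) * \<Phi> \<theta> - \<theta> * W i \<omega>))"
      unfolding g_def by (simp add: prod_ennreal exp_sum)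
    also have "(\<Sum>i\<in>{0..<n}. (\<tau> (Suc i) - \<tau> i) * \<Phi> \<theta> - \<theta> * W i \<omega>) =
        (\<Sum>i\<in>{0..<n}. \<tau> (Suc i) - \<tau> i) * \<Phi> \<theta> - \<theta> * (\<Sum>i\<in>{0..<n}. W i \<omega>)"
      by (subst sum_subtractf) (simp only: sum_distrib_left sum_distrib_right)
    also have "\<dots> = t * \<Phi> \<theta> - \<theta> * \<gamma> t \<omega>"
      using sum_Suc_diff'[of 0 n \<tau>] sum_Suc_diff'[of 0 n "\<lambda>i. \<gamma> (\<tau> i) \<omega>"] \<open>\<gamma> 0 \<omega> = 0\<close>
      by (simp add: W_def \<tau>0 \<tau>n)
    finally show "(\<Prod>i\<in>{0..<n}. g i (W i \<omega>)) = ?D \<omega>" .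
  qed
  have "emeasure (distr M ?P ?X) ?R = (\<integral>\<^sup>+\<omega>. indicator ?R (?X \<omega>) \<partial>M)"
    by (subst nn_integral_indicator[symmetric], simp, subst nn_integral_distr) auto
  also have "\<dots> = (\<integral>\<^sup>+\<omega>. indicator S (\<lambda>i\<in>{0..<n}. c * W i \<omega>) \<partial>M)"
    using AE_start
  proof (intro nn_integral_cong_AE, eventually_elim)
    fix \<omega> assume "\<gamma> 0 \<omega> = 0"
    then show "indicator ?R (?X \<omega>) = (indicator S (\<lambda>i\<in>{0..<n}. c * W i \<omega>) :: ennreal)"
      using S_iff[of "\<lambda>s. c * \<gamma> s \<omega>"] by (simp add: indicator_def in_R \<tau>0 W_def right_diff_distrib)
  qed
  also have "\<dots> = emeasure (distr M (\<Pi>\<^sub>M i\<in>{0..<n}. borel) (\<lambda>\<omega>. \<lambda>i\<in>{0..<n}. c * W i \<omega>)) S"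
    by (subst nn_integral_indicator[symmetric], simp, subst nn_integral_distr) auto
  also have "\<dots> = (\<integral>\<^sup>+\<omega>. (\<Prod>i\<in>{0..<n}. g i (W i \<omega>)) * indicator S (\<lambda>i\<in>{0..<n}. W i \<omega>) \<partial>M)"
    unfolding tilt by (subst nn_integral_indicator[symmetric], simp, subst nn_integral_distr, simp, simp,
          subst nn_integral_density) auto
  also have "\<dots> = (\<integral>\<^sup>+\<omega>. ?D \<omega> * indicator ?R (?Y \<omega>) \<partial>M)"
    using AE_start prod_g
  proof (intro nn_integral_cong_AE, eventually_elim)
    fix \<omega> assume "\<gamma> 0 \<omega> = 0" and eq: "(\<Prod>i\<in>{0..<n}. g i (W i \<omega>)) = ?D \<omega>"
    then have "indicator ?R (?Y \<omega>) = (indicator S (\<lambda>i\<in>{0..<n}. W i \<omega>) :: ennreal)"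
      using S_iff[of "\<lambda>s. \<gamma> s \<omega>"] by (simp add: indicator_def in_R \<tau>0 W_def)
    with eq show "(\<Prod>i\<in>{0..<n}. g i (W i \<omega>)) * indicator S (\<lambda>i\<in>{0..<n}. W i \<omega>) = ?D \<omega> * indicator ?R (?Y \<omega>)"
      by simp
  qed
  also have "\<dots> = emeasure (distr (density M ?D) ?P ?Y) ?R"
    by (subst nn_integral_indicator[symmetric], simp, subst nn_integral_distr, simp, simp,
          subst nn_integral_density) auto
  finally show "emeasure (distr M ?P ?X) ?R = emeasure (distr (density M ?D) ?P ?Y) ?R" .
qed auto

end

section \<open>Scaling becomes invisible near time zero\<close>

context gamma_process begin

text \<open>
  The density \<open>D\<close> has mean \<open>1\<close> and is bounded by \<open>K = exp (t \<Phi>(\<theta>))\<close>, so its mean distance from \<open>1\<close> is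
  at most that of \<open>D\<close> from \<open>K\<close> plus that of \<open>K\<close> from \<open>1\<close>, both equal to \<open>K - 1\<close>.
\<close>

lemma scaling_total_variation_le_1:
  assumes c: "0 < c" "c \<le> 1" and t: "0 < t" and B [measurable]: "B \<in> sets (\<Pi>\<^sub>M s\<in>{0..t}. borel)"
  shows "\<bar>\<P>(\<omega> in M. (\<lambda>s\<in>{0..t}. c * \<gamma> s \<omega>) \<in> B) - \<P>(\<omega> in M. (\<lambda>s\<in>{0..t}. \<gamma> s \<omega>) \<in> B)\<bar>
    \<le> 2 * (exp (t * \<Phi> (b / c - b)) - 1)"
proof -
  define \<theta> where "\<theta> = b / c - b"
  define K where "K = exp (t * \<Phi> \<theta>)"
  define D where "D \<omega> = exp (t * \<Phi> \<theta> - \<theta> * \<gamma> t \<omega>)" for \<omega>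
  have \<theta>: "0 \<le> \<theta>"
    using c b_pos by (simp add: \<theta>_def field_simps)
  have [measurable]: "random_variable borel (\<gamma> t)"
    using t by simp
  have D_meas [measurable]: "random_variable borel D"
    unfolding D_def by measurable
  have [measurable]: "(\<lambda>\<omega>. \<lambda>s\<in>{0..t}. c * \<gamma> s \<omega>) \<in> M \<rightarrow>\<^sub>M (\<Pi>\<^sub>M s\<in>{0..t}. borel)"
    by (intro measurable_restrict) auto
  have D_nonneg: "0 \<le> D \<omega>" for \<omega>
    by (simp add: D_def)
  have D_le: "AE \<omega> in M. D \<omega> \<le> K"
    using AE_nonneg[of t] t \<theta> by (auto simp: D_def K_def elim!: eventually_mono)
  have int_D: "integrable M D"
    using D_le D_nonneg by (intro integrable_const_bound[of _ K]) auto
  have "expectation (\<lambda>\<omega>. exp (- (\<theta> * \<gamma> t \<omega>))) = exp (- (t * \<Phi> \<theta>))"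
    using laplace t \<theta> by (simp add: has_drift_and_levy_measure_def)
  then have E_D: "expectation D = 1"
    by (simp add: D_def[abs_def] exp_diff exp_minus divide_inverse)
  have "expectation D \<le> expectation (\<lambda>_. K)"
    using D_le int_D by (intro integral_mono_AE) auto
  then have K: "1 \<le> K"
    using E_D by (simp add: prob_space)
  let ?I = "\<lambda>\<omega>. indicator B (\<lambda>s\<in>{0..t}. \<gamma> s \<omega>) :: real"
  have "\<P>(\<omega> in M. (\<lambda>s\<in>{0..t}. c * \<gamma> s \<omega>) \<in> B) =
      measure (distr M (\<Pi>\<^sub>M s\<in>{0..t}. borel) (\<lambda>\<omega>. \<lambda>s\<in>{0..t}. c * \<gamma> s \<omega>)) B"
    by (subst measure_distr) (auto intro!: arg_cong[where f = prob])
  also have "\<dots> = (\<integral>x. indicator B x \<partial>distr (density M (\<lambda>\<omega>. ennreal (D \<omega>))) (\<Pi>\<^sub>M s\<in>{0..t}. borel)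
      (\<lambda>\<omega>. \<lambda>s\<in>{0..t}. \<gamma> s \<omega>))"
    unfolding scaled_path_law[OF c t] D_def \<theta>_def using sets.sets_into_space[OF B] by (simp add: Int_absorb2)
  also have "\<dots> = expectation (\<lambda>\<omega>. D \<omega> * ?I \<omega>)"
    using D_nonneg by (subst integral_distr, simp, simp, subst integral_density) auto
  finally have "\<P>(\<omega> in M. (\<lambda>s\<in>{0..t}. c * \<gamma> s \<omega>) \<in> B) = expectation (\<lambda>\<omega>. D \<omega> * ?I \<omega>)" .
  moreover have "\<P>(\<omega> in M. (\<lambda>s\<in>{0..t}. \<gamma> s \<omega>) \<in> B) = expectation ?I"
  proof -
    have "expectation ?I = expectation (indicator {\<omega> \<in> space M. (\<lambda>s\<in>{0..t}. \<gamma> s \<omega>) \<in> B})"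
      by (intro Bochner_Integration.integral_cong) (auto simp: indicator_def)
    then show ?thesis
      by (simp add: Int_absorb2)
  qed
  moreover have int_I: "integrable M ?I"
    by (intro integrable_const_bound[of _ 1]) (auto simp: indicator_def)
  moreover have int_DI: "integrable M (\<lambda>\<omega>. D \<omega> * ?I \<omega>)"
    by (intro Bochner_Integration.integrable_bound[OF int_D]) (auto simp: indicator_def)
  ultimately have "\<bar>\<P>(\<omega> in M. (\<lambda>s\<in>{0..t}. c * \<gamma> s \<omega>) \<in> B) - \<P>(\<omega> in M. (\<lambda>s\<in>{0..t}. \<gamma> s \<omega>) \<in> B)\<bar>
      = \<bar>expectation (\<lambda>\<omega>. D \<omega> * ?I \<omega> - ?I \<omega>)\<bar>"
    by simp
  also have "\<dots> \<le> expectation (\<lambda>\<omega>. \<bar>D \<omega> * ?I \<omega> - ?I \<omega>\<bar>)"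
    by (rule integral_abs_bound)
  also have "\<dots> \<le> expectation (\<lambda>\<omega>. (K - D \<omega>) + (K - 1))"
    using D_le K int_I int_DI int_D by (intro integral_mono_AE) (auto simp: indicator_def elim!: eventually_mono)
  also have "\<dots> = 2 * (K - 1)"
    using int_D E_D by (simp add: prob_space)
  finally show ?thesis
    unfolding K_def \<theta>_def .
qed

text \<open>
  For \<open>c > 1\<close> the path \<open>\<gamma>\<close> is \<open>1 / c\<close> times the path \<open>c \<gamma>\<close>, so the previous bound applies with
  the roles of the two paths exchanged.
\<close>

lemma scaling_total_variation:
  assumes c: "0 < c"
  shows "\<exists>\<kappa>. \<forall>t>0. \<forall>B \<in> sets (\<Pi>\<^sub>M s\<in>{0..t}. borel).
    \<bar>\<P>(\<omega> in M. (\<lambda>s\<in>{0..t}. c * \<gamma> s \<omega>) \<in> B) - \<P>(\<omega> in M. (\<lambda>s\<in>{0..t}. \<gamma> s \<omega>) \<in> B)\<bar>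
      \<le> 2 * (exp (t * \<kappa>) - 1)"
proof (cases "c \<le> 1")
  case True
  then show ?thesis
    using scaling_total_variation_le_1[OF c] by blast
next
  case False
  let ?c = "1 / c"
  have c': "0 < ?c" "?c \<le> 1"
    using False by auto
  show ?thesis
  proof (intro exI[of _ "\<Phi> (b / ?c - b)"] allI impI ballI)
    fix t :: real and B :: "(real \<Rightarrow> real) set"
    assume t: "0 < t" and B [measurable]: "B \<in> sets (\<Pi>\<^sub>M s\<in>{0..t}. borel)"
    let ?P = "\<Pi>\<^sub>M s\<in>{0..t}. (borel :: real measure)"
    let ?B = "{x \<in> space ?P. (\<lambda>s\<in>{0..t}. c * x s) \<in> B}"
    have [measurable]: "(\<lambda>x. \<lambda>s\<in>{0..t}. c * x s) \<in> ?P \<rightarrow>\<^sub>M ?P"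
      by (intro measurable_restrict) auto
    have "?B \<in> sets ?P"
      by measurable
    from scaling_total_variation_le_1[OF c' t this]
    have "\<bar>\<P>(\<omega> in M. (\<lambda>s\<in>{0..t}. ?c * \<gamma> s \<omega>) \<in> ?B) - \<P>(\<omega> in M. (\<lambda>s\<in>{0..t}. \<gamma> s \<omega>) \<in> ?B)\<bar>
      \<le> 2 * (exp (t * \<Phi> (b / ?c - b)) - 1)" .
    moreover have "(\<lambda>s\<in>{0..t}. ?c * \<gamma> s \<omega>) \<in> ?B \<longleftrightarrow> (\<lambda>s\<in>{0..t}. \<gamma> s \<omega>) \<in> B"
      "(\<lambda>s\<in>{0..t}. \<gamma> s \<omega>) \<in> ?B \<longleftrightarrow> (\<lambda>s\<in>{0..t}. c * \<gamma> s \<omega>) \<in> B" for \<omega>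
      using c by (auto simp: space_PiM cong: restrict_cong)
    ultimately show "\<bar>\<P>(\<omega> in M. (\<lambda>s\<in>{0..t}. c * \<gamma> s \<omega>) \<in> B) - \<P>(\<omega> in M. (\<lambda>s\<in>{0..t}. \<gamma> s \<omega>) \<in> B)\<bar>
      \<le> 2 * (exp (t * \<Phi> (b / ?c - b)) - 1)"
      by (simp only: abs_minus_commute)
  qed
qed

lemma scaling_vanishes_at_germ:
  assumes c: "0 < c" and t: "\<And>n. 0 < t n" "t \<longlonglongrightarrow> 0"
    and B: "\<And>n. B n \<in> sets (\<Pi>\<^sub>M s\<in>{0..t n}. borel)"
  shows "(\<lambda>n. \<P>(\<omega> in M. (\<lambda>s\<in>{0..t n}. c * \<gamma> s \<omega>) \<in> B n) - \<P>(\<omega> in M. (\<lambda>s\<in>{0..t n}. \<gamma> s \<omega>) \<in> B n)) \<longlonglongrightarrow> 0"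
proof -
  obtain \<kappa> where \<kappa>: "\<forall>t>0. \<forall>B \<in> sets (\<Pi>\<^sub>M s\<in>{0..t}. borel).
    \<bar>\<P>(\<omega> in M. (\<lambda>s\<in>{0..t}. c * \<gamma> s \<omega>) \<in> B) - \<P>(\<omega> in M. (\<lambda>s\<in>{0..t}. \<gamma> s \<omega>) \<in> B)\<bar>
      \<le> 2 * (exp (t * \<kappa>) - 1)"
    using scaling_total_variation[OF c] ..
  have "(\<lambda>n. 2 * (exp (t n * \<kappa>) - 1)) \<longlonglongrightarrow> 2 * (exp (0 * \<kappa>) - 1)"
    by (intro tendsto_intros t)
  then have "(\<lambda>n. 2 * (exp (t n * \<kappa>) - 1)) \<longlonglongrightarrow> 0" by simp
  moreover have "\<forall>n. norm (\<P>(\<omega> in M. (\<lambda>s\<in>{0..t n}. c * \<gamma> s \<omega>) \<in> B n) - \<P>(\<omega> in M. (\<lambda>s\<in>{0..t n}. \<gamma> s \<omega>) \<in> B n))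
      \<le> 2 * (exp (t n * \<kappa>) - 1)"
    using \<kappa> t(1) B by simp
  ultimately show ?thesis
    by (rule Lim_null_comparison[OF always_eventually, rotated])
qed

end

section \<open>Germ events are independent of the scale\<close>

lemma process_sigma_mono: "S \<subseteq> T \<Longrightarrow> process_sigma M X S \<subseteq> process_sigma M X T"
  unfolding process_sigma_def by (intro sigma_sets_mono') auto

text \<open>
  The form in which a germ event is compared under two laws of the path: the set \<open>B\<close> of paths is the same
  for every process.
\<close>

lemma process_sigma_eq_path_events:
  "process_sigma M X T =
    {(\<lambda>\<omega>. \<lambda>s\<in>T. X s \<omega>) -` B \<inter> space M | B. B \<in> sets (\<Pi>\<^sub>M s\<in>T. borel)}"
  (is "_ = {?X -` B \<inter> space M | B. B \<in> sets ?P}")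
proof -
  let ?G = "\<Union>s\<in>T. {X s -` B \<inter> space M | B. B \<in> sets borel}"
  have space: "?X \<in> space M \<rightarrow> space ?P"
    by (auto simp: space_PiM)
  have G: "?G \<subseteq> Pow (space M)" by auto
  have X: "?X \<in> sigma (space M) ?G \<rightarrow>\<^sub>M ?P"
  proof (intro measurable_restrict)
    fix s assume "s \<in> T"
    then have "X s -` B \<inter> space M \<in> ?G" if "B \<in> sets borel" for B
      using that by blast
    then show "X s \<in> sigma (space M) ?G \<rightarrow>\<^sub>M borel"
      using G by (intro measurableI) (simp_all add: sigma_sets.Basic)
  qed
  have "?X -` B \<inter> space M \<in> process_sigma M X T" if "B \<in> sets ?P" for B
    using measurable_sets[OF X that] G by (simp add: process_sigma_def)
  moreover have "process_sigma M X T \<subseteq> sets (vimage_algebra (space M) ?X ?P)"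
  proof -
    have "X s -` B \<inter> space M \<in> sets (vimage_algebra (space M) ?X ?P)" if "s \<in> T" "B \<in> sets borel" for s B
    proof -
      have "{x \<in> space ?P. x s \<in> B} \<in> sets ?P"
        using that by measurable
      from in_vimage_algebra[OF this, of ?X "space M"]
      have "?X -` {x \<in> space ?P. x s \<in> B} \<inter> space M \<in> sets (vimage_algebra (space M) ?X ?P)" .
      moreover have "?X -` {x \<in> space ?P. x s \<in> B} \<inter> space M = X s -` B \<inter> space M"
        using that by (auto simp: space_PiM)
      ultimately show ?thesis by (simp only:)
    qed
    then have "?G \<subseteq> sets (vimage_algebra (space M) ?X ?P)" by auto
    from sets.sigma_sets_subset[OF this] show ?thesis
      by (simp add: process_sigma_def)
  qed
  ultimately show ?thesis
    unfolding sets_vimage_algebra2[OF space] by auto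
qed

locale scaled_gamma_process = gamma_process +
  fixes \<xi> :: "'a \<Rightarrow> real"
  assumes scale_measurable [measurable]: "random_variable borel \<xi>"
    and scale_pos: "\<omega> \<in> space M \<Longrightarrow> 0 < \<xi> \<omega>"
    and scale_indep: "indep_of_process \<xi> \<gamma>"
begin

lemma scale_path_joint_law:
  "distr M borel \<xi> \<Otimes>\<^sub>M distr M (\<Pi>\<^sub>M s\<in>{0..t}. borel) (\<lambda>\<omega>. \<lambda>s\<in>{0..t}. \<gamma> s \<omega>) =
    distr M (borel \<Otimes>\<^sub>M (\<Pi>\<^sub>M s\<in>{0..t}. borel)) (\<lambda>\<omega>. (\<xi> \<omega>, \<lambda>s\<in>{0..t}. \<gamma> s \<omega>))"
    (is "?L \<Otimes>\<^sub>M ?N = distr M (borel \<Otimes>\<^sub>M ?P) (\<lambda>\<omega>. (\<xi> \<omega>, ?Y \<omega>))")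
proof (rule pair_measure_eqI)
  interpret L: prob_space ?L by (rule prob_space_distr) simp
  interpret N: prob_space ?N by (rule prob_space_distr) simp
  show "sigma_finite_measure ?L" "sigma_finite_measure ?N" ..
  show "sets (?L \<Otimes>\<^sub>M ?N) = sets (distr M (borel \<Otimes>\<^sub>M ?P) (\<lambda>\<omega>. (\<xi> \<omega>, ?Y \<omega>)))"
    by (simp cong: sets_pair_measure_cong)
  fix C B assume "C \<in> sets ?L" "B \<in> sets ?N"
  then have [measurable]: "C \<in> sets borel" "B \<in> sets ?P" by simp_all
  have "?Y -` B \<inter> space M \<in> process_sigma M \<gamma> {0..t}"
    unfolding process_sigma_eq_path_events by auto
  then have "?Y -` B \<inter> space M \<in> process_sigma M \<gamma> {0..}"
    using process_sigma_mono[of "{0..t}" "{0..}" M \<gamma>] by auto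
  then have "prob ((\<xi> -` C \<inter> space M) \<inter> (?Y -` B \<inter> space M)) =
      prob (\<xi> -` C \<inter> space M) * prob (?Y -` B \<inter> space M)"
    by (intro indep_setD[OF scale_indep[unfolded indep_of_process_def]]) auto
  moreover have "(\<lambda>\<omega>. (\<xi> \<omega>, ?Y \<omega>)) -` (C \<times> B) \<inter> space M = (\<xi> -` C \<inter> space M) \<inter> (?Y -` B \<inter> space M)"
    by auto
  ultimately show "emeasure ?L C * emeasure ?N B =
      emeasure (distr M (borel \<Otimes>\<^sub>M ?P) (\<lambda>\<omega>. (\<xi> \<omega>, ?Y \<omega>))) (C \<times> B)"
    by (simp add: emeasure_distr emeasure_eq_measure ennreal_mult)
qed

text \<open>
  Fubini's theorem for the product law of \<open>\<xi>\<close> and the path; \<open>F x\<close> is the conditional probability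
  given \<open>\<xi> = x\<close>.
\<close>

lemma scaled_event_prob:
  assumes B [measurable]: "B \<in> sets (\<Pi>\<^sub>M s\<in>{0..t}. borel)" and C [measurable]: "C \<in> sets borel"
  defines "F \<equiv> \<lambda>x. \<P>(\<omega> in M. (\<lambda>s\<in>{0..t}. x * \<gamma> s \<omega>) \<in> B)"
  shows "(\<lambda>\<omega>. F (\<xi> \<omega>)) \<in> borel_measurable M"
    and "\<P>(\<omega> in M. (\<lambda>s\<in>{0..t}. \<xi> \<omega> * \<gamma> s \<omega>) \<in> B \<and> \<xi> \<omega> \<in> C) =
      expectation (\<lambda>\<omega>. indicator C (\<xi> \<omega>) * F (\<xi> \<omega>))"
proof -
  let ?P = "\<Pi>\<^sub>M s\<in>{0..t}. (borel :: real measure)"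
  let ?Y = "\<lambda>\<omega>. \<lambda>s\<in>{0..t}. \<gamma> s \<omega>"
  let ?L = "distr M borel \<xi>" and ?N = "distr M ?P ?Y"
  interpret L: prob_space ?L by (rule prob_space_distr) simp
  interpret N: prob_space ?N by (rule prob_space_distr) simp
  interpret LN: pair_prob_space ?L ?N ..
  have scale_meas [measurable]: "(\<lambda>p. \<lambda>s\<in>{0..t}. fst p * snd p s) \<in> borel \<Otimes>\<^sub>M ?P \<rightarrow>\<^sub>M ?P"
    by (intro measurable_restrict) measurable
  define f :: "real \<times> (real \<Rightarrow> real) \<Rightarrow> real"
    where "f p = indicator C (fst p) * indicator B (\<lambda>s\<in>{0..t}. fst p * snd p s)" for p
  have f [measurable]: "f \<in> borel_measurable (borel \<Otimes>\<^sub>M ?P)"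
    unfolding f_def by measurable
  have F: "F x = (\<integral>p. indicator B (\<lambda>s\<in>{0..t}. x * p s) \<partial>?N)" for x
  proof -
    have [measurable]: "(\<lambda>p. \<lambda>s\<in>{0..t}. x * p s) \<in> ?P \<rightarrow>\<^sub>M ?P"
      by (intro measurable_restrict) measurable
    have "(\<integral>p. indicat_real B (\<lambda>s\<in>{0..t}. x * p s) \<partial>?N) =
        expectation (\<lambda>\<omega>. indicator B (\<lambda>s\<in>{0..t}. x * ?Y \<omega> s))"
      by (subst integral_distr) auto
    also have "\<dots> = expectation (indicator {\<omega> \<in> space M. (\<lambda>s\<in>{0..t}. x * \<gamma> s \<omega>) \<in> B})"
      by (intro Bochner_Integration.integral_cong) (auto simp: indicator_def cong: restrict_cong)
    also have "\<dots> = F x"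
      by (simp add: F_def Int_absorb2)
    finally show ?thesis ..
  qed
  have F_meas [measurable]: "F \<in> borel_measurable borel"
    unfolding F by measurable
  show "(\<lambda>\<omega>. F (\<xi> \<omega>)) \<in> borel_measurable M"
    by measurable
  have "\<P>(\<omega> in M. (\<lambda>s\<in>{0..t}. \<xi> \<omega> * \<gamma> s \<omega>) \<in> B \<and> \<xi> \<omega> \<in> C) =
      expectation (indicator {\<omega> \<in> space M. (\<lambda>s\<in>{0..t}. \<xi> \<omega> * \<gamma> s \<omega>) \<in> B \<and> \<xi> \<omega> \<in> C})"
    by (simp add: Int_absorb2)
  also have "\<dots> = expectation (\<lambda>\<omega>. f (\<xi> \<omega>, ?Y \<omega>))"
    by (intro Bochner_Integration.integral_cong) (auto simp: f_def indicator_def cong: restrict_cong)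
  also have "\<dots> = (\<integral>p. f p \<partial>distr M (borel \<Otimes>\<^sub>M ?P) (\<lambda>\<omega>. (\<xi> \<omega>, ?Y \<omega>)))"
    by (subst integral_distr) auto
  also have "distr M (borel \<Otimes>\<^sub>M ?P) (\<lambda>\<omega>. (\<xi> \<omega>, ?Y \<omega>)) = ?L \<Otimes>\<^sub>M ?N"
    by (rule scale_path_joint_law[symmetric])
  also have "(\<integral>p. f p \<partial>(?L \<Otimes>\<^sub>M ?N)) = (\<integral>x. (\<integral>y. f (x, y) \<partial>?N) \<partial>?L)"
    by (intro LN.integral_fst'[symmetric] LN.P.integrable_const_bound[of _ 1])
       (auto simp: f_def indicator_def)
  also have "\<dots> = (\<integral>x. indicator C x * F x \<partial>?L)"
    by (simp add: f_def F)
  also have "\<dots> = expectation (\<lambda>\<omega>. indicator C (\<xi> \<omega>) * F (\<xi> \<omega>))"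
    by (subst integral_distr) auto
  finally show "\<P>(\<omega> in M. (\<lambda>s\<in>{0..t}. \<xi> \<omega> * \<gamma> s \<omega>) \<in> B \<and> \<xi> \<omega> \<in> C) =
      expectation (\<lambda>\<omega>. indicator C (\<xi> \<omega>) * F (\<xi> \<omega>))" .
qed

text \<open>
  The conditional probability of \<open>A\<close> given \<open>\<xi> = x\<close> is \<open>F n x\<close> for every \<open>n\<close>, and \<open>F n x - p n\<close>
  tends to \<open>0\<close>. Integrating over \<open>\<xi> \<in> C\<close> shows that \<open>p n\<close> times the probability of \<open>\<xi> \<in> C\<close> tends to
  the probability of \<open>A\<close> and \<open>\<xi> \<in> C\<close>; with \<open>C = UNIV\<close> the limit of \<open>p n\<close> is the probability of \<open>A\<close>.
\<close>

lemma germ_event_indep_scale: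
  assumes A: "A \<in> germ_sigma M (\<lambda>s \<omega>. \<xi> \<omega> * \<gamma> s \<omega>)" and C [measurable]: "C \<in> sets borel"
  shows "prob (A \<inter> {\<omega> \<in> space M. \<xi> \<omega> \<in> C}) = prob A * \<P>(\<omega> in M. \<xi> \<omega> \<in> C)"
proof -
  define t where "t n = 1 / real (Suc n)" for n
  have t: "0 < t n" for n by (simp add: t_def)
  have t_lim: "t \<longlonglongrightarrow> 0"
    unfolding t_def[abs_def] using LIMSEQ_inverse_real_of_nat by (simp add: inverse_eq_divide)
  have "\<forall>n. \<exists>B. B \<in> sets (\<Pi>\<^sub>M s\<in>{0..t n}. borel) \<and> A = (\<lambda>\<omega>. \<lambda>s\<in>{0..t n}. \<xi> \<omega> * \<gamma> s \<omega>) -` B \<inter> space M"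
  proof
    fix n
    have "A \<in> process_sigma M (\<lambda>s \<omega>. \<xi> \<omega> * \<gamma> s \<omega>) {0..t n}"
      using A t[of n] by (simp add: germ_sigma_def)
    then show "\<exists>B. B \<in> sets (\<Pi>\<^sub>M s\<in>{0..t n}. borel) \<and> A = (\<lambda>\<omega>. \<lambda>s\<in>{0..t n}. \<xi> \<omega> * \<gamma> s \<omega>) -` B \<inter> space M"
      unfolding process_sigma_eq_path_events by auto
  qed
  from choice[OF this] obtain B where B [measurable]: "\<And>n. B n \<in> sets (\<Pi>\<^sub>M s\<in>{0..t n}. borel)"
    and AB: "\<And>n. A = (\<lambda>\<omega>. \<lambda>s\<in>{0..t n}. \<xi> \<omega> * \<gamma> s \<omega>) -` B n \<inter> space M"
    by auto
  define F where "F n x = \<P>(\<omega> in M. (\<lambda>s\<in>{0..t n}. x * \<gamma> s \<omega>) \<in> B n)" for n x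
  define p where "p n = \<P>(\<omega> in M. (\<lambda>s\<in>{0..t n}. \<gamma> s \<omega>) \<in> B n)" for n
  have F_meas [measurable]: "(\<lambda>\<omega>. F n (\<xi> \<omega>)) \<in> borel_measurable M" for n
    using scaled_event_prob(1)[OF B, of UNIV] unfolding F_def by simp
  have F_bounds: "0 \<le> F n x" "F n x \<le> 1" for n x
    by (simp_all add: F_def)
  have lim: "(\<lambda>n. p n * \<P>(\<omega> in M. \<xi> \<omega> \<in> C)) \<longlonglongrightarrow> prob (A \<inter> {\<omega> \<in> space M. \<xi> \<omega> \<in> C})"
    if C [measurable]: "C \<in> sets borel" for C
  proof -
    let ?D = "\<lambda>n \<omega>. indicator C (\<xi> \<omega>) * (F n (\<xi> \<omega>) - p n)"
    have "(\<lambda>n. expectation (?D n)) \<longlonglongrightarrow> expectation (\<lambda>_. 0)"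
    proof (rule integral_dominated_convergence[where w = "\<lambda>_. 1"])
      show "AE \<omega> in M. (\<lambda>n. ?D n \<omega>) \<longlonglongrightarrow> 0"
      proof (rule AE_I2)
        fix \<omega> assume "\<omega> \<in> space M"
        from scaling_vanishes_at_germ[OF scale_pos[OF this] t t_lim B]
        have "(\<lambda>n. F n (\<xi> \<omega>) - p n) \<longlonglongrightarrow> 0"
          by (simp add: F_def p_def)
        then show "(\<lambda>n. ?D n \<omega>) \<longlonglongrightarrow> 0"
          by (rule tendsto_mult_right_zero)
      qed
      have "\<bar>F n x - p n\<bar> \<le> 1" for n x
        by (simp add: F_def p_def abs_le_iff)
           (smt (verit) measure_nonneg prob_le_1)
      then show "AE \<omega> in M. norm (?D n \<omega>) \<le> 1" for n
        by (auto simp: indicator_def)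
    qed auto
    moreover have "prob (A \<inter> {\<omega> \<in> space M. \<xi> \<omega> \<in> C}) - p n * \<P>(\<omega> in M. \<xi> \<omega> \<in> C) = expectation (?D n)" for n
    proof -
      have "A \<inter> {\<omega> \<in> space M. \<xi> \<omega> \<in> C} =
          {\<omega> \<in> space M. (\<lambda>s\<in>{0..t n}. \<xi> \<omega> * \<gamma> s \<omega>) \<in> B n \<and> \<xi> \<omega> \<in> C}"
        unfolding AB[of n] by auto
      then have "prob (A \<inter> {\<omega> \<in> space M. \<xi> \<omega> \<in> C}) = expectation (\<lambda>\<omega>. indicator C (\<xi> \<omega>) * F n (\<xi> \<omega>))"
        unfolding F_def by (simp add: scaled_event_prob(2)[OF B C])
      moreover have "\<P>(\<omega> in M. \<xi> \<omega> \<in> C) = expectation (\<lambda>\<omega>. indicator C (\<xi> \<omega>))"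
      proof -
        have "expectation (\<lambda>\<omega>. indicat_real C (\<xi> \<omega>)) = expectation (indicator {\<omega> \<in> space M. \<xi> \<omega> \<in> C})"
          by (intro Bochner_Integration.integral_cong) (auto simp: indicator_def)
        then show ?thesis by (simp add: Int_absorb2)
      qed
      moreover have "integrable M (\<lambda>\<omega>. indicator C (\<xi> \<omega>) * F n (\<xi> \<omega>))"
        using F_bounds by (intro integrable_const_bound[of _ 1]) (auto split: split_indicator)
      moreover have "integrable M (\<lambda>\<omega>. indicator C (\<xi> \<omega>) :: real)"
        by (intro integrable_const_bound[of _ 1]) (auto simp: indicator_def)
      ultimately show ?thesis
        by (simp add: right_diff_distrib mult.commute[of _ "p n"])
    qed
    ultimately have "(\<lambda>n. prob (A \<inter> {\<omega> \<in> space M. \<xi> \<omega> \<in> C}) - p n * \<P>(\<omega> in M. \<xi> \<omega> \<in> C)) \<longlonglongrightarrow> 0"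
      by simp
    from tendsto_diff[OF tendsto_const[of "prob (A \<inter> {\<omega> \<in> space M. \<xi> \<omega> \<in> C})"] this] show ?thesis
      by simp
  qed
  have "A \<inter> space M = A"
    unfolding AB[of 0] by auto
  with lim[of UNIV] have "p \<longlonglongrightarrow> prob A"
    by (simp add: prob_space)
  from tendsto_mult_right[OF this] lim[OF C] show ?thesis
    by (rule LIMSEQ_unique[symmetric])
qed

end

section \<open>Independence of past and future\<close>

text \<open>
  The class \<open>\<A>\<close> of admissible coordinate sets is a parameter: all Borel sets are convenient for the
  independence of past and future, whereas the passage to the limit at time zero is carried out
  for open half-lines.
\<close>

definition cylinder_events ::
    "'a measure \<Rightarrow> (real \<Rightarrow> 'a \<Rightarrow> real) \<Rightarrow> real set \<Rightarrow> real set set \<Rightarrow> 'a set set" where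
  "cylinder_events M X T \<A> =
    {{\<omega> \<in> space M. \<forall>s\<in>J. X s \<omega> \<in> A s} | J A. finite J \<and> J \<subseteq> T \<and> (\<forall>s. A s \<in> \<A>)}"

lemma Int_stable_cylinder_events:
  assumes "Int_stable \<A>"
  shows "Int_stable (cylinder_events M X T \<A>)"
proof (rule Int_stableI)
  fix E F assume "E \<in> cylinder_events M X T \<A>" "F \<in> cylinder_events M X T \<A>"
  then obtain J A K B where
    E: "E = {\<omega> \<in> space M. \<forall>s\<in>J. X s \<omega> \<in> A s}" "finite J" "J \<subseteq> T" "\<And>s. A s \<in> \<A>" and
    F: "F = {\<omega> \<in> space M. \<forall>s\<in>K. X s \<omega> \<in> B s}" "finite K" "K \<subseteq> T" "\<And>s. B s \<in> \<A>"
    unfolding cylinder_events_def by blast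
  define C where "C s = (if s \<in> J \<inter> K then A s \<inter> B s else if s \<in> J then A s else B s)" for s
  have "C s \<in> \<A>" for s
    using E(4) F(4) Int_stableD[OF assms] by (simp add: C_def)
  moreover have "E \<inter> F = {\<omega> \<in> space M. \<forall>s\<in>J \<union> K. X s \<omega> \<in> C s}"
    unfolding E(1) F(1) C_def by auto
  ultimately show "E \<inter> F \<in> cylinder_events M X T \<A>"
    unfolding cylinder_events_def using E(2,3) F(2,3) by (intro CollectI exI[of _ "J \<union> K"] exI[of _ C]) simp
qed

lemma process_sigma_subset_cylinder_sigma:
  assumes "sets borel = sigma_sets UNIV \<A>"
  shows "process_sigma M X T \<subseteq> sigma_sets (space M) (cylinder_events M X T \<A>)"
  unfolding process_sigma_def
proof (rule sigma_sets_mono, rule UN_least)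
  fix s assume s: "s \<in> T"
  have "{X s -` B \<inter> space M | B. B \<in> sets borel} = sigma_sets (space M) {X s -` B \<inter> space M | B. B \<in> \<A>}"
    unfolding assms by (rule sigma_sets_vimage_commute) simp
  also have "\<dots> \<subseteq> sigma_sets (space M) (cylinder_events M X T \<A>)"
  proof (rule sigma_sets_mono')
    have "X s -` B \<inter> space M \<in> cylinder_events M X T \<A>" if "B \<in> \<A>" for B
      unfolding cylinder_events_def using s that
      by (intro CollectI exI[of _ "{s}"] exI[of _ "\<lambda>_. B"]) auto
    then show "{X s -` B \<inter> space M | B. B \<in> \<A>} \<subseteq> cylinder_events M X T \<A>" by auto
  qed
  finally show "{X s -` B \<inter> space M | B. B \<in> sets borel} \<subseteq> sigma_sets (space M) (cylinder_events M X T \<A>)" .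
qed

lemma process_sigma_subset_sigma:
  assumes "G \<subseteq> Pow (space M)" "\<And>s. s \<in> T \<Longrightarrow> X s \<in> sigma (space M) G \<rightarrow>\<^sub>M borel"
  shows "process_sigma M X T \<subseteq> sigma_sets (space M) G"
  unfolding process_sigma_def
proof (rule sigma_sets_mono, rule UN_least, rule subsetI)
  fix s E assume "s \<in> T" "E \<in> {X s -` B \<inter> space M | B. B \<in> sets borel}"
  then show "E \<in> sigma_sets (space M) G"
    using measurable_sets[OF assms(2)] assms(1) by auto
qed

lemma measurable_process_sigma:
  assumes "s \<in> T"
  shows "X s \<in> sigma (space M) (process_sigma M X T) \<rightarrow>\<^sub>M borel"
proof -
  have "process_sigma M X T \<subseteq> Pow (space M)"
    unfolding process_sigma_eq_path_events by auto
  moreover have "X s -` B \<inter> space M \<in> process_sigma M X T" if "B \<in> sets borel" for B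
    unfolding process_sigma_def using assms that by (intro sigma_sets.Basic) auto
  ultimately show ?thesis
    by (intro measurableI) (simp_all add: sigma_sets.Basic)
qed

context subordinator_process begin

lemma process_sigma_events: "T \<subseteq> {0..} \<Longrightarrow> process_sigma M \<gamma> T \<subseteq> events"
  unfolding process_sigma_eq_path_events
  by (auto intro!: measurable_sets measurable_restrict random_variable_at)

text \<open>
  Cylinder events of the past and of the future are, up to null sets, events of the increments over
  the two parts of a common grid that contains \<open>\<epsilon>\<close>. The null set is the one where \<open>\<gamma>\<close> does not start
  at \<open>0\<close>.
\<close>

lemma past_future_indep:
  assumes "0 \<le> \<epsilon>"
  shows "indep_set (process_sigma M \<gamma> {0..\<epsilon>}) (process_sigma M (\<lambda>s \<omega>. \<gamma> s \<omega> - \<gamma> \<epsilon> \<omega>) {\<epsilon>..})"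
proof -
  let ?F = "\<lambda>s \<omega>. \<gamma> s \<omega> - \<gamma> \<epsilon> \<omega>"
  let ?b = "sets (borel :: real measure)"
  have cyl: "prob (P \<inter> Q) = prob P * prob Q" "P \<in> events" "Q \<in> events"
    if PQ: "P \<in> cylinder_events M \<gamma> {0..\<epsilon>} ?b" "Q \<in> cylinder_events M ?F {\<epsilon>..} ?b" for P Q
  proof -
    obtain J A where P: "P = {\<omega> \<in> space M. \<forall>s\<in>J. \<gamma> s \<omega> \<in> A s}"
      and J: "finite J" "J \<subseteq> {0..\<epsilon>}" and A: "\<And>s. A s \<in> ?b"
      using PQ(1) unfolding cylinder_events_def by blast
    obtain K B where Q: "Q = {\<omega> \<in> space M. \<forall>s\<in>K. ?F s \<omega> \<in> B s}"
      and K: "finite K" "K \<subseteq> {\<epsilon>..}" and B: "\<And>s. B s \<in> ?b"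
      using PQ(2) unfolding cylinder_events_def by blast
    have [measurable]: "random_variable borel (\<gamma> s)" if "s \<in> J \<union> K" for s
      using J K that \<open>0 \<le> \<epsilon>\<close> by (intro random_variable_at) force
    have [measurable]: "random_variable borel (\<gamma> \<epsilon>)"
      using \<open>0 \<le> \<epsilon>\<close> by simp
    note [measurable] = A B
    show P_ev: "P \<in> events"
      unfolding P using J(1) by (intro sets.sets_Collect_finite_All) (auto intro!: measurable_sets_borel)
    show Q_ev: "Q \<in> events"
      unfolding Q using K(1) by (intro sets.sets_Collect_finite_All) (auto intro!: measurable_sets_borel)
    let ?L = "insert 0 (insert \<epsilon> (J \<union> K))"
    obtain \<tau> :: "nat \<Rightarrow> real" and n where \<tau>: "strict_mono_on {..n} \<tau>" "\<tau> ` {..n} = ?L"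
      by (rule finite_set_increasing_enumeration[of ?L]) (use J K in auto)
    have range: "0 \<le> \<tau> i" if "i \<le> n" for i
    proof -
      have "\<tau> i \<in> ?L" using \<tau>(2) that by blast
      with J K \<open>0 \<le> \<epsilon>\<close> show ?thesis by force
    qed
    have le_iff: "\<tau> i \<le> \<tau> j \<longleftrightarrow> i \<le> j" if "i \<le> n" "j \<le> n" for i j
      using strict_mono_on_less_eq[OF \<tau>(1)] that by simp
    have "0 \<in> \<tau> ` {..n}" "\<epsilon> \<in> \<tau> ` {..n}"
      using \<tau>(2) by auto
    then obtain i0 k where i0: "i0 \<le> n" "\<tau> i0 = 0" and k: "k \<le> n" "\<tau> k = \<epsilon>"
      by auto
    have \<tau>0: "\<tau> 0 = 0"
      using le_iff[of 0 i0] range[of 0] i0 by simp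
    have index: "\<exists>i\<le>n. \<tau> i = s" if "s \<in> J \<union> K" for s
    proof -
      have "s \<in> \<tau> ` {..n}" using \<tau>(2) that by blast
      then show ?thesis by auto
    qed
    have J_sub: "J \<subseteq> \<tau> ` {0..k}"
    proof
      fix s assume s: "s \<in> J"
      then obtain i where "i \<le> n" "\<tau> i = s" using index by auto
      moreover have "s \<le> \<tau> k" using s J k by auto
      ultimately show "s \<in> \<tau> ` {0..k}" using le_iff[of i k] k by auto
    qed
    have K_sub: "K \<subseteq> \<tau> ` {k..n}"
    proof
      fix s assume s: "s \<in> K"
      then obtain i where "i \<le> n" "\<tau> i = s" using index by auto
      moreover have "\<tau> k \<le> s" using s K k by auto
      ultimately show "s \<in> \<tau> ` {k..n}" using le_iff[of k i] k by auto
    qed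
    let ?W = "\<lambda>i \<omega>. \<gamma> (\<tau> (Suc i)) \<omega> - \<gamma> (\<tau> i) \<omega>"
    let ?P1 = "\<Pi>\<^sub>M i\<in>{0..<k}. (borel :: real measure)" and ?P2 = "\<Pi>\<^sub>M i\<in>{k..<n}. (borel :: real measure)"
    obtain S1 where S1: "S1 \<in> sets ?P1"
      and S1_iff: "X (\<tau> 0) = 0 \<Longrightarrow> (\<forall>s\<in>J. X s \<in> A s) = ((\<lambda>i\<in>{0..<k}. X (\<tau> (Suc i)) - X (\<tau> i)) \<in> S1)" for X
      using finite_dimensional_event_via_increments[OF J(1) J_sub, of A] A by auto
    obtain S2 where S2: "S2 \<in> sets ?P2"
      and S2_iff: "X (\<tau> k) = 0 \<Longrightarrow> (\<forall>s\<in>K. X s \<in> B s) = ((\<lambda>i\<in>{k..<n}. X (\<tau> (Suc i)) - X (\<tau> i)) \<in> S2)" for X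
      using finite_dimensional_event_via_increments[OF K(1) K_sub, of B] B by auto
    let ?V1 = "\<lambda>\<omega>. \<lambda>i\<in>{0..<k}. ?W i \<omega>" and ?V2 = "\<lambda>\<omega>. \<lambda>i\<in>{k..<n}. ?W i \<omega>"
    have V: "indep_var ?P1 ?V1 ?P2 ?V2"
      using increments_indep[OF \<tau>(1)] range[of 0] k(1) by (intro indep_var_restrict) auto
    then have [measurable]: "?V1 \<in> M \<rightarrow>\<^sub>M ?P1" "?V2 \<in> M \<rightarrow>\<^sub>M ?P2"
      by (auto dest: indep_var_rv1 indep_var_rv2)
    let ?P' = "?V1 -` S1 \<inter> space M" and ?Q' = "?V2 -` S2 \<inter> space M"
    have ev': "?P' \<in> events" "?Q' \<in> events"
      using S1 S2 by (auto intro!: measurable_sets)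
    have ae: "AE \<omega> in M. (\<omega> \<in> P \<longleftrightarrow> \<omega> \<in> ?P') \<and> (\<omega> \<in> Q \<longleftrightarrow> \<omega> \<in> ?Q')"
      using AE_start
    proof eventually_elim
      fix \<omega> assume "\<gamma> 0 \<omega> = 0"
      then show "(\<omega> \<in> P \<longleftrightarrow> \<omega> \<in> ?P') \<and> (\<omega> \<in> Q \<longleftrightarrow> \<omega> \<in> ?Q')"
        using S1_iff[of "\<lambda>s. \<gamma> s \<omega>"] S2_iff[of "\<lambda>s. ?F s \<omega>"] \<tau>0 k unfolding P Q by auto
    qed
    have "prob (P \<inter> Q) = prob (?P' \<inter> ?Q')"
      using P_ev Q_ev ev' by (intro finite_measure_eq_AE eventually_mono[OF ae]) auto
    also have "?P' \<inter> ?Q' = (\<lambda>\<omega>. (?V1 \<omega>, ?V2 \<omega>)) -` (S1 \<times> S2) \<inter> space M"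
      by auto
    also have "prob \<dots> = prob ?P' * prob ?Q'"
      by (rule indep_varD[OF V S1 S2])
    also have "prob ?P' = prob P"
      using P_ev ev' by (intro finite_measure_eq_AE eventually_mono[OF ae]) auto
    also have "prob ?Q' = prob Q"
      using Q_ev ev' by (intro finite_measure_eq_AE eventually_mono[OF ae]) auto
    finally show "prob (P \<inter> Q) = prob P * prob Q" .
  qed
  have full: "space M \<in> cylinder_events M X T ?b" for X T
    unfolding cylinder_events_def by (intro CollectI exI[of _ "{}"] exI[of _ "\<lambda>_. UNIV"]) simp
  have "indep_set (cylinder_events M \<gamma> {0..\<epsilon>} ?b) (cylinder_events M ?F {\<epsilon>..} ?b)"
    unfolding indep_sets2_eq using cyl full by blast
  then have "indep_set (sigma_sets (space M) (cylinder_events M \<gamma> {0..\<epsilon>} ?b))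
      (sigma_sets (space M) (cylinder_events M ?F {\<epsilon>..} ?b))"
    by (intro indep_set_sigma_sets Int_stable_cylinder_events) (auto simp: Int_stable_def)
  moreover have "sets borel = sigma_sets UNIV ?b"
    using sets.sigma_sets_eq[of "borel :: real measure"] by simp
  note sub = process_sigma_subset_cylinder_sigma[OF this]
  ultimately show ?thesis
    using sub[of M \<gamma> "{0..\<epsilon>}"] sub[of M ?F "{\<epsilon>..}"] unfolding indep_sets2_eq by blast
qed

end

section \<open>The zero-one law\<close>

lemma (in prob_space) prob_Int_tendsto_AE:
  assumes "H \<in> events" "\<And>n. G n \<in> events" "G' \<in> events"
    and "AE \<omega> in M. \<forall>\<^sub>F n in sequentially. \<omega> \<in> G n \<longleftrightarrow> \<omega> \<in> G'"
  shows "(\<lambda>n. prob (H \<inter> G n)) \<longlonglongrightarrow> prob (H \<inter> G')"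
proof -
  have "(\<lambda>n. expectation (indicat_real (H \<inter> G n))) \<longlonglongrightarrow> expectation (indicat_real (H \<inter> G'))"
  proof (rule integral_dominated_convergence[where w = "\<lambda>_. 1"])
    show "AE \<omega> in M. (\<lambda>n. indicat_real (H \<inter> G n) \<omega>) \<longlonglongrightarrow> indicat_real (H \<inter> G') \<omega>"
      using assms(4)
      by eventually_elim (auto intro!: tendsto_eventually elim!: eventually_mono simp: indicator_def)
  qed (use assms in \<open>auto simp: indicator_def\<close>)
  moreover have "expectation (indicat_real E) = prob E" if "E \<in> events" for E
    using that by simp
  ultimately show ?thesis
    using assms(1-3) by simp
qed

lemma Int_stable_pairwise_Int:
  assumes "Int_stable \<E>" "Int_stable \<F>"
  shows "Int_stable {E \<inter> F | E F. E \<in> \<E> \<and> F \<in> \<F>}"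
proof (rule Int_stableI)
  fix A B assume "A \<in> {E \<inter> F | E F. E \<in> \<E> \<and> F \<in> \<F>}" "B \<in> {E \<inter> F | E F. E \<in> \<E> \<and> F \<in> \<F>}"
  then obtain E F E' F' where "A = E \<inter> F" "B = E' \<inter> F'" "E \<in> \<E>" "E' \<in> \<E>" "F \<in> \<F>" "F' \<in> \<F>"
    by blast
  moreover from this have "A \<inter> B = (E \<inter> E') \<inter> (F \<inter> F')" by blast
  moreover have "E \<inter> E' \<in> \<E>" "F \<inter> F' \<in> \<F>"
    using calculation Int_stableD assms by metis+
  ultimately show "A \<inter> B \<in> {E \<inter> F | E F. E \<in> \<E> \<and> F \<in> \<F>}" by blast
qed

text \<open>
  Replacing \<open>\<gamma>\<close> at \<open>s\<close> by its increment since the small time \<open>t n\<close> lowers it by an amount that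
  tends to \<open>0\<close>. For open half-lines that are unbounded above the indicator then converges: a value above
  \<open>e s\<close> stays above eventually, and a value not above \<open>e s\<close> is only lowered. The maximum
  with \<open>t n\<close> takes care of \<open>s = 0\<close>, where both sides vanish.
\<close>

lemma (in subordinator_process) shifted_increment_eventually:
  assumes t: "\<And>n::nat. 0 < t n" "t \<longlonglongrightarrow> 0" and J: "finite J" "J \<subseteq> {0..}"
  shows "AE \<omega> in M. \<forall>\<^sub>F n in sequentially.
    (\<forall>s\<in>J. \<gamma> (max s (t n)) \<omega> - \<gamma> (t n) \<omega> \<in> {e s<..}) = (\<forall>s\<in>J. \<gamma> s \<omega> \<in> {e s<..})"
  using AE_paths
proof eventually_elim
  fix \<omega> assume path: "\<gamma> 0 \<omega> = 0 \<and> mono_on {0..} (\<lambda>t. \<gamma> t \<omega>) \<and>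
    (\<forall>t\<ge>0. continuous (at_right t) (\<lambda>s. \<gamma> s \<omega>))"
  have "filterlim t (at_right 0) sequentially"
    using t by (auto simp: filterlim_at less_imp_neq[symmetric])
  moreover have "((\<lambda>s. \<gamma> s \<omega>) \<longlongrightarrow> \<gamma> 0 \<omega>) (at_right 0)"
    using path by (auto simp: continuous_within)
  ultimately have "(\<lambda>n. \<gamma> (t n) \<omega>) \<longlonglongrightarrow> \<gamma> 0 \<omega>"
    by (rule filterlim_compose[rotated])
  with path have lim: "(\<lambda>n. \<gamma> (t n) \<omega>) \<longlonglongrightarrow> 0" by simp
  have nonneg: "0 \<le> \<gamma> (t n) \<omega>" for n
    using path t(1)[of n] by (auto dest: mono_onD[of _ _ 0 "t n"])
  have "\<forall>\<^sub>F n in sequentially. (\<gamma> (max s (t n)) \<omega> - \<gamma> (t n) \<omega> > e s) = (\<gamma> s \<omega> > e s)" if "s \<in> J" for s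
  proof (cases "s = 0")
    case True
    have "max s (t n) = t n" for n
      using t(1)[of n] True by simp
    then show ?thesis
      using path True by simp
  next
    case False
    then have "0 < s" using J that by force
    then have max: "\<forall>\<^sub>F n in sequentially. max s (t n) = s"
      using order_tendstoD(2)[OF t(2), of s] by (auto elim!: eventually_mono)
    show ?thesis
    proof (cases "\<gamma> s \<omega> > e s")
      case True
      then have "\<forall>\<^sub>F n in sequentially. \<gamma> (t n) \<omega> < \<gamma> s \<omega> - e s"
        using order_tendstoD(2)[OF lim, of "\<gamma> s \<omega> - e s"] by simp
      with max show ?thesis
        by eventually_elim (use True in simp)
    next
      case False
      from max show ?thesis
      proof eventually_elim
        fix n assume "max s (t n) = s"
        then show "(\<gamma> (max s (t n)) \<omega> - \<gamma> (t n) \<omega> > e s) = (\<gamma> s \<omega> > e s)"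
          using False nonneg[of n] by simp
      qed
    qed
  qed
  then have "\<forall>\<^sub>F n in sequentially. \<forall>s\<in>J. (\<gamma> (max s (t n)) \<omega> - \<gamma> (t n) \<omega> > e s) = (\<gamma> s \<omega> > e s)"
    using J(1) by (intro eventually_ball_finite) auto
  then show "\<forall>\<^sub>F n in sequentially.
      (\<forall>s\<in>J. \<gamma> (max s (t n)) \<omega> - \<gamma> (t n) \<omega> \<in> {e s<..}) = (\<forall>s\<in>J. \<gamma> s \<omega> \<in> {e s<..})"
    by eventually_elim simp
qed

context scaled_gamma_process begin

abbreviation scale_events :: "'a set set" where
  "scale_events \<equiv> {\<xi> -` C \<inter> space M | C. C \<in> sets borel}"

lemma Int_stable_scale_events: "Int_stable scale_events"
proof (rule Int_stableI)
  fix E F assume "E \<in> scale_events" "F \<in> scale_events"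
  then obtain C D where "E = \<xi> -` C \<inter> space M" "F = \<xi> -` D \<inter> space M" "C \<in> sets borel" "D \<in> sets borel"
    by blast
  then show "E \<inter> F \<in> scale_events"
    by (intro CollectI exI[of _ "C \<inter> D"]) auto
qed

lemma space_in_scale_events: "space M \<in> scale_events"
  by (intro CollectI exI[of _ UNIV]) simp

text \<open>
  Intersections of scale events with a class that generates the path form a class that generates
  \<open>\<xi>\<close> and \<open>\<gamma>\<close>, and therefore also their product.
\<close>

lemma scaled_process_sigma_subset:
  assumes \<G>: "process_sigma M \<gamma> T \<subseteq> sigma_sets (space M) \<G>" "\<G> \<subseteq> Pow (space M)" "space M \<in> \<G>"
  shows "process_sigma M (\<lambda>s \<omega>. \<xi> \<omega> * \<gamma> s \<omega>) T \<subseteq>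
    sigma_sets (space M) {E \<inter> G | E G. E \<in> scale_events \<and> G \<in> \<G>}"
proof (rule process_sigma_subset_sigma)
  let ?R = "{E \<inter> G | E G. E \<in> scale_events \<and> G \<in> \<G>}"
  show R: "?R \<subseteq> Pow (space M)" by auto
  have "\<G> \<subseteq> ?R"
  proof
    fix G assume "G \<in> \<G>"
    with \<G>(2) have "G = space M \<inter> G" by auto
    with \<open>G \<in> \<G>\<close> space_in_scale_events show "G \<in> ?R" by blast
  qed
  then have "process_sigma M \<gamma> T \<subseteq> sigma_sets (space M) ?R"
    using \<G>(1) sigma_sets_mono'[of \<G> ?R "space M"] by simp
  moreover have "\<gamma> s -` B \<inter> space M \<in> process_sigma M \<gamma> T" if "s \<in> T" "B \<in> sets borel" for s B
    unfolding process_sigma_def using that by (intro sigma_sets.Basic) auto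
  ultimately have \<gamma>: "\<gamma> s \<in> sigma (space M) ?R \<rightarrow>\<^sub>M borel" if "s \<in> T" for s
    using R that by (intro measurableI) (simp_all add: subset_iff)
  have "\<xi> -` B \<inter> space M \<in> ?R" if "B \<in> sets borel" for B
  proof -
    have "\<xi> -` B \<inter> space M = (\<xi> -` B \<inter> space M) \<inter> space M" by auto
    with that \<G>(3) show ?thesis by blast
  qed
  then have \<xi>: "\<xi> \<in> sigma (space M) ?R \<rightarrow>\<^sub>M borel"
    using R by (intro measurableI) (simp_all add: sigma_sets.Basic)
  fix s assume "s \<in> T"
  from \<xi> \<gamma>[OF this] show "(\<lambda>\<omega>. \<xi> \<omega> * \<gamma> s \<omega>) \<in> sigma (space M) ?R \<rightarrow>\<^sub>M borel"
    by (rule borel_measurable_times)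
qed

lemma scale_events_indep:
  assumes "E \<in> scale_events" "G \<in> process_sigma M \<gamma> {0..}"
  shows "prob (E \<inter> G) = prob E * prob G"
  using indep_setD[OF scale_indep[unfolded indep_of_process_def] assms] .

text \<open>
  The variables up to time \<open>\<epsilon>\<close>, those after it, and \<open>\<xi>\<close> are three independent groups; hence the
  first and the third together are independent of the second.
\<close>

lemma scaled_past_future_indep:
  assumes \<epsilon>: "0 \<le> \<epsilon>"
    and A: "A \<in> process_sigma M (\<lambda>s \<omega>. \<xi> \<omega> * \<gamma> s \<omega>) {0..\<epsilon>}" and E: "E \<in> scale_events"
  shows "A \<inter> E \<in> events"
    and "G \<in> process_sigma M (\<lambda>s \<omega>. \<gamma> s \<omega> - \<gamma> \<epsilon> \<omega>) {\<epsilon>..} \<Longrightarrow>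
      prob (A \<inter> E \<inter> G) = prob (A \<inter> E) * prob G"
proof -
  let ?past = "process_sigma M \<gamma> {0..\<epsilon>}" and ?future = "process_sigma M (\<lambda>s \<omega>. \<gamma> s \<omega> - \<gamma> \<epsilon> \<omega>) {\<epsilon>..}"
  let ?R = "{E \<inter> P | E P. E \<in> scale_events \<and> P \<in> ?past}"
  have alg: "sigma_algebra (space M) (process_sigma M X T)" for X :: "real \<Rightarrow> 'a \<Rightarrow> real" and T
    unfolding process_sigma_def by (rule sigma_algebra_sigma_sets) auto
  interpret past: sigma_algebra "space M" ?past by (rule alg)
  interpret future: sigma_algebra "space M" ?future by (rule alg)
  interpret whole: sigma_algebra "space M" "process_sigma M \<gamma> {0..}" by (rule alg)
  have past_whole: "?past \<subseteq> process_sigma M \<gamma> {0..}"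
    by (rule process_sigma_mono) auto
  have future_whole: "?future \<subseteq> process_sigma M \<gamma> {0..}"
  proof -
    have pow: "process_sigma M \<gamma> {0..} \<subseteq> Pow (space M)"
      using whole.space_closed .
    have "?future \<subseteq> sigma_sets (space M) (process_sigma M \<gamma> {0..})"
      using \<epsilon> by (intro process_sigma_subset_sigma[OF pow] borel_measurable_diff measurable_process_sigma) auto
    then show ?thesis
      by (simp add: whole.sigma_sets_eq)
  qed
  have events: "?past \<subseteq> events" "?future \<subseteq> events"
    using past_whole future_whole process_sigma_events[of "{0..}"] by auto
  have scale_ev: "scale_events \<subseteq> events" by auto
  have past_stable: "Int_stable ?past"
    by (rule past.Int_stable)
  have "indep_set ?R ?future"
    unfolding indep_sets2_eq
  proof (intro conjI ballI)
    show "?R \<subseteq> events" using events scale_ev by blast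
    fix H G assume "H \<in> ?R" and G: "G \<in> ?future"
    then obtain E P where H: "H = E \<inter> P" and E: "E \<in> scale_events" and P: "P \<in> ?past" by blast
    have PG: "P \<inter> G \<in> process_sigma M \<gamma> {0..}"
      using P G past_whole future_whole by (intro whole.Int) auto
    have "prob (H \<inter> G) = prob (E \<inter> (P \<inter> G))"
      by (simp add: H Int_assoc)
    also have "\<dots> = prob E * prob (P \<inter> G)"
      by (rule scale_events_indep[OF E PG])
    also have "prob (P \<inter> G) = prob P * prob G"
      by (rule indep_setD[OF past_future_indep[OF \<epsilon>] P G])
    also have "prob E * (prob P * prob G) = prob H * prob G"
      unfolding H using scale_events_indep[OF E, of P] P past_whole by auto
    finally show "prob (H \<inter> G) = prob H * prob G" .
  qed (rule events)
  then have "indep_set (sigma_sets (space M) ?R) (sigma_sets (space M) ?future)"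
    by (intro indep_set_sigma_sets Int_stable_pairwise_Int Int_stable_scale_events past_stable future.Int_stable)
  then have indep: "indep_set (sigma_sets (space M) ?R) ?future"
    by (simp add: future.sigma_sets_eq)
  have R: "?R \<subseteq> Pow (space M)" by auto
  interpret R: sigma_algebra "space M" "sigma_sets (space M) ?R"
    by (rule sigma_algebra_sigma_sets[OF R])
  have "A \<in> sigma_sets (space M) ?R"
    using scaled_process_sigma_subset[OF equalityD2[OF past.sigma_sets_eq] past.space_closed past.top] A
    by (rule subsetD)
  moreover have "E \<in> ?R"
  proof -
    have "E \<subseteq> space M" using E by blast
    then have "E = E \<inter> space M" by (rule Int_absorb2[symmetric])
    then show ?thesis
      by (intro CollectI exI[of _ E] exI[of _ "space M"] conjI E past.top)
  qed
  then have "E \<in> sigma_sets (space M) ?R"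
    by (rule sigma_sets.Basic)
  ultimately have AE: "A \<inter> E \<in> sigma_sets (space M) ?R"
    by (rule R.Int)
  show "prob (A \<inter> E \<inter> G) = prob (A \<inter> E) * prob G" if "G \<in> ?future"
    by (rule indep_setD[OF indep AE that])
  show "A \<inter> E \<in> events"
    using indep_setD_ev1[OF indep] AE by (rule subsetD)
qed

text \<open>
  The event \<open>A\<close> is independent of the events \<open>E \<inter> G\<close>, where \<open>E\<close> is a scale event and \<open>G\<close> a cylinder
  event of \<open>\<gamma>\<close>. They are closed under intersection and generate a \<open>\<sigma>\<close>-field that contains \<open>A\<close>.
\<close>

lemma germ_trivial:
  assumes A: "A \<in> germ_sigma M (\<lambda>s \<omega>. \<xi> \<omega> * \<gamma> s \<omega>)"
  shows "prob A = 0 \<or> prob A = 1"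
proof -
  let ?Ioi = "range (\<lambda>x::real. {x<..})"
  let ?cyl = "cylinder_events M \<gamma> {0..1} ?Ioi"
  define t where "t n = 1 / real (Suc n)" for n
  have t: "0 < t n" for n by (simp add: t_def)
  have t_lim: "t \<longlonglongrightarrow> 0"
    unfolding t_def[abs_def] using LIMSEQ_inverse_real_of_nat by (simp add: inverse_eq_divide)
  have A_t: "A \<in> process_sigma M (\<lambda>s \<omega>. \<xi> \<omega> * \<gamma> s \<omega>) {0..u}" if "0 < u" for u
    using A that by (simp add: germ_sigma_def)
  have borel: "sets borel = sigma_sets UNIV ?Ioi"
    by (subst borel_Ioi) simp
  have space_cyl: "space M \<in> ?cyl"
    unfolding cylinder_events_def by (intro CollectI exI[of _ "{}"] exI[of _ "\<lambda>_. {0<..}"]) auto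
  have cyl_space: "?cyl \<subseteq> Pow (space M)"
    by (auto simp: cylinder_events_def)
  have cyl_stable: "Int_stable ?cyl"
  proof (rule Int_stable_cylinder_events, rule Int_stableI)
    fix a b assume "a \<in> ?Ioi" "b \<in> ?Ioi"
    then obtain x y :: real where "a = {x<..}" "b = {y<..}" by auto
    then have "a \<inter> b = {max x y<..}" by auto
    then show "a \<inter> b \<in> ?Ioi" by simp
  qed
  have cyl: "G \<in> process_sigma M \<gamma> {0..}" "prob (A \<inter> E \<inter> G) = prob (A \<inter> E) * prob G"
    if G: "G \<in> ?cyl" and E: "E \<in> scale_events" for E G
  proof -
    obtain J B where G_eq: "G = {\<omega> \<in> space M. \<forall>s\<in>J. \<gamma> s \<omega> \<in> B s}"
      and J: "finite J" "J \<subseteq> {0..1}" and B: "\<And>s. B s \<in> ?Ioi"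
      using G unfolding cylinder_events_def by blast
    have "\<exists>x. B s = {x<..}" for s
      using B[of s] by auto
    then obtain e where e: "\<And>s. B s = {e s<..}" by metis
    have cyl_in: "{\<omega> \<in> space M. \<forall>s\<in>J. X (u s) \<omega> \<in> {e s<..}} \<in> process_sigma M X T"
      if "u ` J \<subseteq> T" for X T and u :: "real \<Rightarrow> real"
    proof -
      interpret T: sigma_algebra "space M" "process_sigma M X T"
        unfolding process_sigma_def by (rule sigma_algebra_sigma_sets) auto
      show ?thesis
      proof (rule T.sets_Collect_finite_All[OF _ J(1)])
        fix s assume "s \<in> J"
        then have "X (u s) -` {e s<..} \<inter> space M \<in> process_sigma M X T"
          unfolding process_sigma_def using that
          by (intro sigma_sets.Basic UN_I[of "u s"] CollectI exI[of _ "{e s<..}"]) auto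
        moreover have "X (u s) -` {e s<..} \<inter> space M = {\<omega> \<in> space M. X (u s) \<omega> \<in> {e s<..}}"
          by auto
        ultimately show "{\<omega> \<in> space M. X (u s) \<omega> \<in> {e s<..}} \<in> process_sigma M X T"
          by (simp only:)
      qed
    qed
    show G_whole: "G \<in> process_sigma M \<gamma> {0..}"
      unfolding G_eq e using J by (intro cyl_in[of "\<lambda>s. s"]) auto
    then have G_ev: "G \<in> events"
      using process_sigma_events[of "{0..}"] by auto
    \<comment> \<open>The cylinder event \<open>G\<close> for the increments since the small time \<open>t n\<close>.\<close>
    define G' where "G' n = {\<omega> \<in> space M. \<forall>s\<in>J. \<gamma> (max s (t n)) \<omega> - \<gamma> (t n) \<omega> \<in> {e s<..}}" for n
    have G'_future: "G' n \<in> process_sigma M (\<lambda>s \<omega>. \<gamma> s \<omega> - \<gamma> (t n) \<omega>) {t n..}" for n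
      unfolding G'_def by (intro cyl_in[of "\<lambda>s. max s (t n)"]) auto
    have G'_ev: "G' n \<in> events" for n
      by (rule subsetD[OF indep_setD_ev2[OF past_future_indep[OF less_imp_le[OF t]]] G'_future])
    note indep = scaled_past_future_indep[OF less_imp_le[OF t] A_t[OF t] E]
    have J_nonneg: "J \<subseteq> {0..}" using J(2) by auto
    have ae: "AE \<omega> in M. \<forall>\<^sub>F n in sequentially. \<omega> \<in> G' n \<longleftrightarrow> \<omega> \<in> G"
      using shifted_increment_eventually[OF t t_lim J(1) J_nonneg, of e] AE_space
      by eventually_elim (simp add: G'_def G_eq e)
    have "(\<lambda>n. prob (A \<inter> E \<inter> G' n)) \<longlonglongrightarrow> prob (A \<inter> E \<inter> G)"
      using indep(1) G'_ev G_ev ae by (rule prob_Int_tendsto_AE)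
    moreover have "(\<lambda>n. prob (space M \<inter> G' n)) \<longlonglongrightarrow> prob (space M \<inter> G)"
      using sets.top G'_ev G_ev ae by (rule prob_Int_tendsto_AE)
    then have "(\<lambda>n. prob (A \<inter> E) * prob (G' n)) \<longlonglongrightarrow> prob (A \<inter> E) * prob G"
      using G'_ev G_ev by (intro tendsto_mult_left) simp
    ultimately show "prob (A \<inter> E \<inter> G) = prob (A \<inter> E) * prob G"
      unfolding indep(2)[OF G'_future] by (rule LIMSEQ_unique)
  qed
  have A_ev: "A \<in> events"
  proof -
    have "A \<inter> space M \<in> events"
      by (rule scaled_past_future_indep(1)[OF less_imp_le[OF t] A_t[OF t] space_in_scale_events])
    moreover have "A \<subseteq> space M"
      using A_t[of 1] unfolding process_sigma_eq_path_events by auto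
    ultimately show ?thesis by (simp add: Int_absorb2)
  qed
  have "indep_set {A} {E \<inter> G | E G. E \<in> scale_events \<and> G \<in> ?cyl}"
    unfolding indep_sets2_eq
  proof (intro conjI ballI)
    show "{E \<inter> G | E G. E \<in> scale_events \<and> G \<in> ?cyl} \<subseteq> events"
    proof
      fix H assume "H \<in> {E \<inter> G | E G. E \<in> scale_events \<and> G \<in> ?cyl}"
      then obtain E G where H: "H = E \<inter> G" and E: "E \<in> scale_events" and G: "G \<in> ?cyl" by blast
      have "E \<in> events" using E by (auto intro: measurable_sets)
      moreover have "G \<in> events"
        using process_sigma_events[OF order_refl] cyl(1)[OF G E] by (rule subsetD)
      ultimately show "H \<in> events" unfolding H by (rule sets.Int)
    qed
    fix a H assume "a \<in> {A}" "H \<in> {E \<inter> G | E G. E \<in> scale_events \<and> G \<in> ?cyl}"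
    then obtain E G where a: "a = A" and H: "H = E \<inter> G" and E: "E \<in> scale_events" and G: "G \<in> ?cyl" by blast
    from E obtain C where "E = \<xi> -` C \<inter> space M" and C: "C \<in> sets borel"
      by blast
    then have E_eq: "E = {\<omega> \<in> space M. \<xi> \<omega> \<in> C}"
      by (simp add: vimage_def Int_def conj_commute)
    have "prob (a \<inter> H) = prob (A \<inter> E) * prob G"
      using cyl(2)[OF G E] by (simp add: a H Int_assoc)
    also have "prob (A \<inter> E) = prob A * prob E"
      unfolding E_eq by (rule germ_event_indep_scale[OF A C])
    also have "prob A * prob E * prob G = prob a * prob H"
      unfolding H a using scale_events_indep[OF E cyl(1)[OF G E]] by simp
    finally show "prob (a \<inter> H) = prob a * prob H" .
  qed (use A_ev in simp)
  then have "indep_set (sigma_sets (space M) {A})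
      (sigma_sets (space M) {E \<inter> G | E G. E \<in> scale_events \<and> G \<in> ?cyl})"
    by (intro indep_set_sigma_sets Int_stable_pairwise_Int Int_stable_scale_events cyl_stable)
       (auto simp: Int_stable_def)
  moreover have "A \<in> sigma_sets (space M) {A}" by auto
  moreover have "A \<in> sigma_sets (space M) {E \<inter> G | E G. E \<in> scale_events \<and> G \<in> ?cyl}"
    using scaled_process_sigma_subset[OF process_sigma_subset_cylinder_sigma[OF borel] cyl_space space_cyl]
      A_t[OF zero_less_one] by (rule subsetD)
  ultimately have "prob (A \<inter> A) = prob A * prob A"
    by (rule indep_setD)
  then show ?thesis by simp
qed

end

theorem proposition1:
  fixes M :: "'a measure" and \<gamma> :: "real \<Rightarrow> 'a \<Rightarrow> real" and \<xi> :: "'a \<Rightarrow> real"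
  assumes "prob_space M"
    and "prob_space.gamma_subordinator M \<gamma>"
    and "\<xi> \<in> borel_measurable M"
    and "\<And>\<omega>. \<omega> \<in> space M \<Longrightarrow> 0 < \<xi> \<omega>"
    and "prob_space.indep_of_process M \<xi> \<gamma>"
  shows "\<forall>A \<in> germ_sigma M (\<lambda>s \<omega>. \<xi> \<omega> * \<gamma> s \<omega>). measure M A = 0 \<or> measure M A = 1"
proof -
  interpret prob_space M by fact
  from assms(2) obtain a b where ab: "subordinator \<gamma>" "0 < a" "0 < b"
    "has_drift_and_levy_measure \<gamma> 0 (gamma_levy_measure a b)"
    unfolding gamma_subordinator_def by blast
  interpret scaled_gamma_process M \<gamma> a b \<xi>
    by unfold_locales (use ab assms in auto)
  show ?thesis
    using germ_trivial by blast
qed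

end
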